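(* Let $\mu\in\mathcal P$ be fixed, and let $1\leq i\leq L$ be such that $k_i+q_i-1\leq N$. For $j=1,\ldots,q_i$ set $$\tilde d_{k_i+j-1}(\mu):=\min_{k_i+q_i-1<l\le\mathcal N}\left|\frac{\lambda_l(\mu)-\lambda_{\mathrm{red},\,k_i+j-1}(\mu)}{\lambda_l(\mu)}\right| .$$ Then, for every $j\in\{1,\ldots,q_i\}$ with $\tilde d_{k_i+j-1}(\mu)\neq 0$, $$0\leq \lambda_{\mathrm{red},\,k_i+j-1}(\mu)-\lambda_{k_i}(\mu)\leq \frac{\|r_{k_i+j-1}(\cdot;\mu)\|_{\mu;V'}^2}{\tilde d_{k_i+j-1}(\mu)}\left(1+\frac{\|r_{k_i+j-1}(\cdot;\mu)\|_{\mu;V'}}{\tilde d_{k_i+j-1}(\mu)^2\,\sqrt{\lambda_{k_i}(\mu)}}\right).$$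
   Context: Setting. Let $\Omega\subset\mathbb R^d$, $d\in\{2,3\}$, be a bounded polygonal (polyhedral) domain, and let $\Gamma_D\subset\partial\Omega$ be a closed non-trivial subset of its boundary (Dirichlet part). Let $\mathcal P\subset\mathbb R^P$ be a parameter set. For $\mu\in\mathcal P$ let $\mathbb C(\mu)$ be a Hooke's (elasticity) tensor with the usual symmetries, uniformly positive definite and piecewise constant with respect to a fixed decomposition of $\Omega$ into non-overlapping subdomains. With $\epsilon(u)=\frac12(\nabla u+\nabla u^T)$ define the symmetric bilinear forms $$a(u,v;\mu)=\int_\Omega \mathbb C(\mu)\epsilon(u):\epsilon(v)\,dx,\qquad m(u,v)=\int_\Omega u\cdot v\,dx .$$ Let $V\subset\{v\in (H^1(\Omega))^d : v|_{\Gamma_D}=0\}$ be a fixed conforming finite element space of finite dimension $\mathcal N$. The form $a(\cdot,\cdot;\mu)$ is positive definite on $V$. Detailed eigenvalue problem. Find $(u(\mu),\lambda(\mu))\in V\times\mathbb R$, $u(\mu)\ne0$, with $a(u(\mu),v;\mu)=\lambda(\mu)\,m(u(\mu),v)$ for all $v\in V$. The eigenvalues, counted with multiplicity, are $0<\lambda_1(\mu)\le\dots\le\lambda_{\mathcal N}(\mu)$, with eigenfunctions $u_1(\mu),\dots,u_{\mathcal N}(\mu)\in V$ normalized by $m(u_i(\mu),u_j(\mu))=\delta_{ij}$. Let $L\geq 1$ be the number of distinct eigenvalues. For $i=1,\dots,L$, $k_i$ denotes the lowest index of the $i$-th distinct eigenvalue and $q_i$ its multiplicity, so $\lambda_{k_i}(\mu)=\dots=\lambda_{k_i+q_i-1}(\mu)$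 (the numbers $L,k_i,q_i$ depend on $\mu$). Reduced eigenvalue problem. Let $V_N\subset V$ be a subspace of dimension $N<\mathcal N$. Find $(u_{\mathrm{red}}(\mu),\lambda_{\mathrm{red}}(\mu))\in V_N\times\mathbb R$, $u_{\mathrm{red}}(\mu)\neq 0$, with $a(u_{\mathrm{red}}(\mu),v;\mu)=\lambda_{\mathrm{red}}(\mu)\,m(u_{\mathrm{red}}(\mu),v)$ for all $v\in V_N$. The reduced eigenvalues, counted with multiplicity, are $\lambda_{\mathrm{red},1}(\mu)\le\dots\le\lambda_{\mathrm{red},N}(\mu)$, with eigenfunctions $u_{\mathrm{red},1}(\mu),\dots,u_{\mathrm{red},N}(\mu)\in V_N$ normalized by $m(u_{\mathrm{red},i}(\mu),u_{\mathrm{red},j}(\mu))=\delta_{ij}$. Residuals and norms. For $i=1,\dots,N$ the residual is the linear functional on $V$ given by $$r_i(v;\mu):=a(u_{\mathrm{red},i}(\mu),v;\mu)-\lambda_{\mathrm{red},i}(\mu)\,m(u_{\mathrm{red},i}(\mu),v),\qquad v\in V.$$ The energy norm is $\|v\|_{\mu;V}:=a(v,v;\mu)^{1/2}$, and for a linear functional $r:V\to\mathbb R$ the dual norm is $\|r\|_{\mu;V'}:=\sup_{0\neq v\in V} r(v)/\|v\|_{\mu;V}$. *)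

theory Defs
  imports "HOL-Analysis.Analysis"
begin

text \<open>
  Elements of Lebesgue and Sobolev spaces on \<open>\<Omega>\<close> are represented by functions on the whole
  space; only their values on \<open>\<Omega>\<close> matter, and functions that agree almost everywhere on \<open>\<Omega>\<close>
  represent the same element.
\<close>

definition polyhedral_domain :: "'a::euclidean_space set \<Rightarrow> bool" where
  "polyhedral_domain \<Omega> \<longleftrightarrow>
     open \<Omega> \<and> connected \<Omega> \<and> \<Omega> \<noteq> {} \<and> bounded \<Omega> \<and> interior (closure \<Omega>) = \<Omega> \<and>
     (\<exists>F. finite F \<and> (\<forall>p\<in>F. polytope p) \<and> closure \<Omega> = \<Union>F)"

coinductive smooth :: "('a::real_normed_vector \<Rightarrow> 'b::real_normed_vector) \<Rightarrow> bool" where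
  "(\<forall>x. f differentiable (at x)) \<Longrightarrow> (\<forall>h. smooth (\<lambda>x. frechet_derivative f (at x) h)) \<Longrightarrow> smooth f"

definition test_function :: "'a::real_normed_vector set \<Rightarrow> ('a \<Rightarrow> real) \<Rightarrow> bool" where
  "test_function \<Omega> \<phi> \<longleftrightarrow>
     smooth \<phi> \<and> (\<exists>K. compact K \<and> K \<subseteq> \<Omega> \<and> (\<forall>x. x \<notin> K \<longrightarrow> \<phi> x = 0))"

definition L2 :: "'a::euclidean_space set \<Rightarrow> ('a \<Rightarrow> 'b::euclidean_space) set" where
  "L2 \<Omega> = {v. v \<in> borel_measurable (lebesgue_on \<Omega>) \<and>
              integrable (lebesgue_on \<Omega>) (\<lambda>x. (norm (v x))\<^sup>2)}"

text \<open>Row \<open>i\<close>, column \<open>j\<close> of \<open>G x\<close> is the weak derivative of \<open>v\<^sub>i\<close> in direction \<open>x\<^sub>j\<close>.\<close>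

definition weak_gradient ::
    "(real^'d) set \<Rightarrow> (real^'d \<Rightarrow> real^'d) \<Rightarrow> (real^'d \<Rightarrow> real^'d^'d) \<Rightarrow> bool" where
  "weak_gradient \<Omega> v G \<longleftrightarrow> G \<in> L2 \<Omega> \<and>
     (\<forall>\<phi> i j. test_function \<Omega> \<phi> \<longrightarrow>
        (LINT x|lebesgue_on \<Omega>. v x $ i * frechet_derivative \<phi> (at x) (axis j 1)) =
        - (LINT x|lebesgue_on \<Omega>. G x $ i $ j * \<phi> x))"

definition H1 :: "(real^'d) set \<Rightarrow> (real^'d \<Rightarrow> real^'d) set" where
  "H1 \<Omega> = {v \<in> L2 \<Omega>. \<exists>G. weak_gradient \<Omega> v G}"

text \<open>The weak gradient of an element of \<open>H1 \<Omega>\<close> is unique up to a null set.\<close>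

definition grad :: "(real^'d) set \<Rightarrow> (real^'d \<Rightarrow> real^'d) \<Rightarrow> real^'d \<Rightarrow> real^'d^'d" where
  "grad \<Omega> v = (SOME G. weak_gradient \<Omega> v G)"

definition H1_norm :: "(real^'d) set \<Rightarrow> (real^'d \<Rightarrow> real^'d) \<Rightarrow> real" where
  "H1_norm \<Omega> v = sqrt ((LINT x|lebesgue_on \<Omega>. (norm (v x))\<^sup>2) +
                       (LINT x|lebesgue_on \<Omega>. (norm (grad \<Omega> v x))\<^sup>2))"

text \<open>
  Surface measure is the Hausdorff measure of codimension one on the Caratheodory-measurable
  sets. The dimensional normalising constant is omitted, since only null sets and
  \<open>L\<^sup>2\<close>-convergence are used.
\<close>

definition surface_outer_measure :: "(real^'d) set \<Rightarrow> ennreal" where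
  "surface_outer_measure A =
     (SUP \<delta>\<in>{0<..}. INF B\<in>{B :: nat \<Rightarrow> (real^'d) set. A \<subseteq> (\<Union>n. B n) \<and>
                            (\<forall>n. bounded (B n) \<and> diameter (B n) \<le> \<delta>)}.
        (\<Sum>n. ennreal (diameter (B n) ^ (CARD('d) - 1))))"

definition surface_measure :: "(real^'d) measure" where
  "surface_measure =
     measure_of UNIV (lambda_system UNIV UNIV surface_outer_measure) surface_outer_measure"

text \<open>
  The trace operator is the continuous extension, from \<open>H1 \<Omega>\<close> to \<open>L\<^sup>2\<close> of the boundary, of the
  restriction of functions that are smooth up to the boundary.
\<close>

definition has_trace ::
    "(real^'d) set \<Rightarrow> (real^'d \<Rightarrow> real^'d) \<Rightarrow> (real^'d \<Rightarrow> real^'d) \<Rightarrow> bool" where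
  "has_trace \<Omega> v g \<longleftrightarrow> g \<in> borel_measurable surface_measure \<and>
     (\<exists>\<phi> :: nat \<Rightarrow> real^'d \<Rightarrow> real^'d. (\<forall>n. smooth (\<phi> n)) \<and>
        (\<lambda>n. H1_norm \<Omega> (\<lambda>x. \<phi> n x - v x)) \<longlonglongrightarrow> 0 \<and>
        (\<lambda>n. \<integral>\<^sup>+x\<in>frontier \<Omega>. ennreal ((norm (\<phi> n x - g x))\<^sup>2) \<partial>surface_measure) \<longlonglongrightarrow> 0)"

definition H1_Dirichlet :: "(real^'d) set \<Rightarrow> (real^'d) set \<Rightarrow> (real^'d \<Rightarrow> real^'d) set" where
  "H1_Dirichlet \<Omega> \<Gamma> = {v \<in> H1 \<Omega>. \<exists>g. has_trace \<Omega> v g \<and>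
                                (AE x in surface_measure. x \<in> \<Gamma> \<longrightarrow> g x = 0)}"

definition nonoverlapping_decomposition :: "'a::euclidean_space set \<Rightarrow> 'a set set \<Rightarrow> bool" where
  "nonoverlapping_decomposition \<Omega> D \<longleftrightarrow>
     finite D \<and> (\<forall>S\<in>D. open S \<and> connected S \<and> S \<noteq> {} \<and> S \<subseteq> \<Omega>) \<and>
     pairwise disjnt D \<and> negligible (\<Omega> - \<Union>D)"

definition tensor_apply :: "real^'d^'d^'d^'d \<Rightarrow> real^'d^'d \<Rightarrow> real^'d^'d" where
  "tensor_apply T E = (\<chi> i j. \<Sum>k\<in>UNIV. \<Sum>l\<in>UNIV. T $ i $ j $ k $ l * E $ k $ l)"

text \<open>
  The inner product of matrices is the Frobenius product. Values of the tensor field on the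
  null set \<open>\<Omega> - \<Union>D\<close> of interfaces are irrelevant.
\<close>

definition hooke_tensor_field ::
    "(real^'d) set set \<Rightarrow> (real^'d \<Rightarrow> real^'d^'d^'d^'d) \<Rightarrow> bool" where
  "hooke_tensor_field D C \<longleftrightarrow>
     (\<forall>S\<in>D. C constant_on S) \<and>
     (\<forall>x\<in>\<Union>D. \<forall>i j k l. C x $ i $ j $ k $ l = C x $ j $ i $ k $ l \<and>
                        C x $ i $ j $ k $ l = C x $ i $ j $ l $ k \<and>
                        C x $ i $ j $ k $ l = C x $ k $ l $ i $ j) \<and>
     (\<exists>c>0. \<forall>x\<in>\<Union>D. \<forall>E. transpose E = E \<longrightarrow> tensor_apply (C x) E \<bullet> E \<ge> c * (norm E)\<^sup>2)"

definition strain :: "(real^'d) set \<Rightarrow> (real^'d \<Rightarrow> real^'d) \<Rightarrow> real^'d \<Rightarrow> real^'d^'d" where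
  "strain \<Omega> u x = (1/2) *\<^sub>R (grad \<Omega> u x + transpose (grad \<Omega> u x))"

definition a_form :: "(real^'d) set \<Rightarrow> (real^'d \<Rightarrow> real^'d^'d^'d^'d) \<Rightarrow>
    (real^'d \<Rightarrow> real^'d) \<Rightarrow> (real^'d \<Rightarrow> real^'d) \<Rightarrow> real" where
  "a_form \<Omega> C u v = (LINT x|lebesgue_on \<Omega>. tensor_apply (C x) (strain \<Omega> u x) \<bullet> strain \<Omega> v x)"

definition m_form :: "(real^'d) set \<Rightarrow> (real^'d \<Rightarrow> real^'d) \<Rightarrow> (real^'d \<Rightarrow> real^'d) \<Rightarrow> real" where
  "m_form \<Omega> u v = (LINT x|lebesgue_on \<Omega>. u x \<bullet> v x)"

definition ae_zero :: "(real^'d) set \<Rightarrow> (real^'d \<Rightarrow> real^'d) \<Rightarrow> bool" where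
  "ae_zero \<Omega> v \<longleftrightarrow> (AE x in lebesgue_on \<Omega>. v x = 0)"

definition function_subspace :: "(real^'d \<Rightarrow> real^'d) set \<Rightarrow> bool" where
  "function_subspace V \<longleftrightarrow> (\<lambda>x. 0) \<in> V \<and>
     (\<forall>u\<in>V. \<forall>v\<in>V. (\<lambda>x. u x + v x) \<in> V) \<and> (\<forall>c. \<forall>v\<in>V. (\<lambda>x. c *\<^sub>R v x) \<in> V)"

text \<open>Dimension modulo almost-everywhere equality on \<open>\<Omega>\<close>.\<close>

definition has_dimension :: "(real^'d) set \<Rightarrow> (real^'d \<Rightarrow> real^'d) set \<Rightarrow> nat \<Rightarrow> bool" where
  "has_dimension \<Omega> V n \<longleftrightarrow>
     (\<exists>b :: nat \<Rightarrow> real^'d \<Rightarrow> real^'d. (\<forall>i<n. b i \<in> V) \<and>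
        (\<forall>v\<in>V. \<exists>c. ae_zero \<Omega> (\<lambda>x. v x - (\<Sum>i<n. c i *\<^sub>R b i x))) \<and>
        (\<forall>c. ae_zero \<Omega> (\<lambda>x. \<Sum>i<n. c i *\<^sub>R b i x) \<longrightarrow> (\<forall>i<n. c i = 0)))"

text \<open>
  When \<open>W\<close> has dimension \<open>n\<close>, the orthonormal eigenfunctions form a basis of \<open>W\<close>, so that \<open>lam\<close> lists all
  eigenvalues on \<open>W\<close> with multiplicity, indexed from 1.
\<close>

definition eigen_system :: "(real^'d) set \<Rightarrow> (real^'d \<Rightarrow> real^'d^'d^'d^'d) \<Rightarrow>
    (real^'d \<Rightarrow> real^'d) set \<Rightarrow> nat \<Rightarrow> (nat \<Rightarrow> real) \<Rightarrow> (nat \<Rightarrow> real^'d \<Rightarrow> real^'d) \<Rightarrow> bool" where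
  "eigen_system \<Omega> C W n lam u \<longleftrightarrow>
     mono_on {1..n} lam \<and>
     (\<forall>i\<in>{1..n}. u i \<in> W) \<and>
     (\<forall>i\<in>{1..n}. \<forall>j\<in>{1..n}. m_form \<Omega> (u i) (u j) = (if i = j then 1 else 0)) \<and>
     (\<forall>i\<in>{1..n}. \<forall>v\<in>W. a_form \<Omega> C (u i) v = lam i * m_form \<Omega> (u i) v)"

definition num_distinct :: "(nat \<Rightarrow> real) \<Rightarrow> nat \<Rightarrow> nat" where
  "num_distinct lam n = card (lam ` {1..n})"

definition distinct_value :: "(nat \<Rightarrow> real) \<Rightarrow> nat \<Rightarrow> nat \<Rightarrow> real" where
  "distinct_value lam n i = sorted_list_of_set (lam ` {1..n}) ! (i - 1)"

definition lowest_index :: "(nat \<Rightarrow> real) \<Rightarrow> nat \<Rightarrow> nat \<Rightarrow> nat" where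
  "lowest_index lam n i = Min {l \<in> {1..n}. lam l = distinct_value lam n i}"

definition eigen_multiplicity :: "(nat \<Rightarrow> real) \<Rightarrow> nat \<Rightarrow> nat \<Rightarrow> nat" where
  "eigen_multiplicity lam n i = card {l \<in> {1..n}. lam l = distinct_value lam n i}"

definition residual :: "(real^'d) set \<Rightarrow> (real^'d \<Rightarrow> real^'d^'d^'d^'d) \<Rightarrow>
    (real^'d \<Rightarrow> real^'d) \<Rightarrow> real \<Rightarrow> (real^'d \<Rightarrow> real^'d) \<Rightarrow> real" where
  "residual \<Omega> C w \<theta> v = a_form \<Omega> C w v - \<theta> * m_form \<Omega> w v"

definition energy_norm :: "(real^'d) set \<Rightarrow> (real^'d \<Rightarrow> real^'d^'d^'d^'d) \<Rightarrow>
    (real^'d \<Rightarrow> real^'d) \<Rightarrow> real" where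
  "energy_norm \<Omega> C v = sqrt (a_form \<Omega> C v v)"

definition dual_norm :: "(real^'d) set \<Rightarrow> (real^'d \<Rightarrow> real^'d^'d^'d^'d) \<Rightarrow>
    (real^'d \<Rightarrow> real^'d) set \<Rightarrow> ((real^'d \<Rightarrow> real^'d) \<Rightarrow> real) \<Rightarrow> real" where
  "dual_norm \<Omega> C V r = (SUP v\<in>{v \<in> V. \<not> ae_zero \<Omega> v}. r v / energy_norm \<Omega> C v)"

end

theory Submission
  imports Defs
begin

text \<open>
  Let \<open>w\<close> be a reduced eigenfunction with eigenvalue \<open>\<theta>\<close>, let \<open>c\<^sub>l\<close> be its coordinates in the detailed
  eigenbasis, let \<open>\<kappa> = \<lambda>\<^sub>k\<close> be the target eigenvalue and \<open>K = k + q - 1\<close> the last index of its cluster.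
  The lower bound is the min-max principle. For the upper bound, \<open>R\<^sup>2 = \<Sum> c\<^sub>l\<^sup>2 (\<lambda>\<^sub>l - \<theta>)\<^sup>2 / \<lambda>\<^sub>l\<close>, and since
  \<open>\<Sum> c\<^sub>l\<^sup>2 = 1\<close> and \<open>\<Sum> \<lambda>\<^sub>l c\<^sub>l\<^sup>2 = \<theta>\<close>, dropping the terms with \<open>l \<le> K\<close> gives
  \<open>\<theta> - \<kappa> \<le> \<Sum>\<^sub>l\<^sub>>\<^sub>K c\<^sub>l\<^sup>2 (\<lambda>\<^sub>l - \<theta>) + (\<theta> - \<kappa>) \<beta>\<close> with \<open>\<beta> = \<Sum>\<^sub>l\<^sub>>\<^sub>K c\<^sub>l\<^sup>2\<close>. The gap \<open>d\<close> bounds the first sum by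
  \<open>R\<^sup>2 / d\<close>. It also bounds \<open>\<Sum>\<^sub>l\<^sub>>\<^sub>K c\<^sub>l\<^sup>2 \<lambda>\<^sub>l\<close> by \<open>R\<^sup>2 / d\<^sup>2\<close>, hence \<open>\<theta> - \<kappa> \<le> R\<^sup>2 / d\<^sup>2\<close> and, as \<open>\<beta> \<le> 1\<close>,
  \<open>\<beta> \<le> sqrt \<beta> \<le> R / (d sqrt \<kappa>)\<close>.

  The expansion of the energy form in the eigenbasis needs \<^const>\<open>a_form\<close> to be linear. As \<^const>\<open>grad\<close> picks
  an arbitrary weak gradient, this rests on the uniqueness of weak gradients almost everywhere, that is,
  on the fundamental lemma of the calculus of variations.
\<close>

section \<open>Smooth bump functions\<close>

text \<open>The classical smooth function that is flat at 0, with the powers of \<open>1 / t\<close>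
  that differentiation produces. Keeping \<open>k\<close> as a parameter makes the family closed
  under derivatives up to linear combinations.\<close>

definition flat :: "nat \<Rightarrow> real \<Rightarrow> real" where
  "flat k t = (if t \<le> 0 then 0 else exp (- 1 / t) / t ^ k)"

text \<open>The substitution \<open>s = 1 / t\<close> reduces the right-hand limit to the
  exponential dominating every power.\<close>

lemma flat_tendsto_0: "(flat k \<longlongrightarrow> 0) (at 0)"
proof -
  have "((\<lambda>s. s ^ k / exp s) \<longlongrightarrow> (0::real)) at_top"
    by (rule tendsto_power_div_exp_0)
  then have "((\<lambda>t. inverse t ^ k / exp (inverse t)) \<longlongrightarrow> (0::real)) (at_right 0)"
    using filterlim_compose filterlim_inverse_at_top_right by fastforce
  moreover have "eventually (\<lambda>t. inverse t ^ k / exp (inverse t) = flat k t) (at_right 0)"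
    by (rule eventually_at_rightI[of 0 1])
      (auto simp: flat_def field_simps exp_minus)
  ultimately have r: "(flat k \<longlongrightarrow> 0) (at_right 0)"
    by (rule Lim_transform_eventually)
  have "eventually (\<lambda>t. 0 = flat k t) (at_left 0)"
    by (rule eventually_at_leftI[of "-1"]) (auto simp: flat_def)
  then have "(flat k \<longlongrightarrow> 0) (at_left 0)"
    using Lim_transform_eventually tendsto_const by blast
  with r show ?thesis by (simp add: filterlim_split_at)
qed

lemma flat_has_derivative:
  "(flat k has_real_derivative flat (k + 2) t - real k * flat (k + 1) t) (at t)"
proof (cases t "0::real" rule: linorder_cases)
  case less
  have "((\<lambda>_. 0) has_real_derivative 0) (at t)" by simp
  then have "(flat k has_real_derivative 0) (at t)"
    by (rule has_field_derivative_transform_within_open[of _ _ _ "{..<0}"])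
      (use less in \<open>auto simp: flat_def\<close>)
  then show ?thesis using less by (simp add: flat_def)
next
  case equal
  have "((\<lambda>h. flat (k + 1) h) \<longlongrightarrow> 0) (at 0)" by (rule flat_tendsto_0)
  \<comment> \<open>Since \<open>flat k 0 = 0\<close>, the difference quotient at 0 is the next
    member of the family, whose limit is known. At \<open>h = 0\<close> both sides are 0 by the
    convention for division.\<close>
  moreover have "flat (k + 1) h = (flat k (0 + h) - flat k 0) / h" for h
    by (simp add: flat_def)
  ultimately show ?thesis using equal by (simp add: DERIV_def) (simp add: flat_def)
next
  case greater
  have "((\<lambda>t. exp (- 1 / t) / t ^ k) has_real_derivative
      flat (k + 2) t - real k * flat (k + 1) t) (at t)"
  proof -
    \<comment> \<open>Differentiating \<open>t ^ k\<close> brings in the truncated exponent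
      \<open>k - 1\<close>; the split makes all exponents explicit.\<close>
    consider "k = 0" | "k = Suc 0" | n where "k = Suc (Suc n)"
      by (metis not0_implies_Suc)
    then show ?thesis
      using greater by cases
        (auto intro!: derivative_eq_intros simp: flat_def divide_simps power2_eq_square,
         auto simp: algebra_simps, metis One_nat_def mult.commute neq0_conv power_minus_mult)
  qed
  then show ?thesis
    by (rule has_field_derivative_transform_within_open[of _ _ _ "{0<..}"])
      (use greater in \<open>auto simp: flat_def\<close>)
qed

lemma flat_0_bounds: "0 \<le> flat 0 t" "flat 0 t \<le> 1"
  by (auto simp: flat_def)

text \<open>For positive \<open>t\<close> the exponent \<open>- 1 / (Suc n * t)\<close> tends to 0,
  so rescaling turns the flat function into a step.\<close>

lemma flat_0_scaled_tendsto:
  "(\<lambda>n. flat 0 (real (Suc n) * t)) \<longlonglongrightarrow> (if 0 < t then 1 else 0)"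
proof (cases "0 < t")
  case True
  have "(\<lambda>n. exp (- (1 / t) * inverse (real (Suc n)))) \<longlonglongrightarrow> exp (- (1 / t) * 0)"
    by (intro tendsto_intros LIMSEQ_inverse_real_of_nat)
  moreover have "flat 0 (real (Suc n) * t) = exp (- (1 / t) * inverse (real (Suc n)))" for n
    using True by (simp add: flat_def field_simps add_pos_nonneg not_le)
  ultimately show ?thesis using True by simp
next
  case False
  then have "flat 0 (real (Suc n) * t) = 0" for n
    by (auto simp: flat_def mult_le_0_iff)
  then show ?thesis using False by simp
qed

text \<open>
  The algebra generated by ridge functions built from \<^const>\<open>flat\<close> is closed under directional
  derivatives, so its members are smooth by coinduction.
\<close>

inductive flat_algebra :: "('a::euclidean_space \<Rightarrow> real) \<Rightarrow> bool" where
  const: "flat_algebra (\<lambda>_. c)"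
| flat: "flat_algebra (\<lambda>x. flat k (c + x \<bullet> h))"
| add: "flat_algebra f \<Longrightarrow> flat_algebra g \<Longrightarrow> flat_algebra (\<lambda>x. f x + g x)"
| mult: "flat_algebra f \<Longrightarrow> flat_algebra g \<Longrightarrow> flat_algebra (\<lambda>x. f x * g x)"

lemma flat_algebra_has_derivative:
  assumes "flat_algebra f"
  shows "\<exists>f'. (\<forall>x. (f has_derivative f' x) (at x)) \<and> (\<forall>h. flat_algebra (\<lambda>x. f' x h))"
  using assms
proof induction
  case (const c)
  show ?case
    by (intro exI[of _ "\<lambda>_ _. 0"]) (auto intro: flat_algebra.const)
next
  case (flat k c h)
  \<comment> \<open>The difference is written as a sum with a negative multiple, and
    \<open>y \<bullet> h\<close> is a constant in \<open>x\<close>, so the rules of the algebra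
    apply directly.\<close>
  let ?f' = "\<lambda>x y. (flat (k + 2) (c + x \<bullet> h) + - real k * flat (k + 1) (c + x \<bullet> h)) * (y \<bullet> h)"
  have "((\<lambda>x. flat k (c + x \<bullet> h)) has_derivative ?f' x) (at x)" for x
  proof -
    have "((\<lambda>x. flat k (c + x \<bullet> h)) has_derivative
        (\<lambda>y. (y \<bullet> h) * (flat (k + 2) (c + x \<bullet> h) - real k * flat (k + 1) (c + x \<bullet> h)))) (at x)"
      by (rule has_derivative_compose[where g="flat k" and f="\<lambda>x. c + x \<bullet> h" and f'="\<lambda>y. y \<bullet> h",
          of x UNIV, simplified])
       (auto intro!: derivative_eq_intros flat_has_derivative[unfolded has_field_derivative_def, THEN has_derivative_eq_rhs] simp: mult.commute)
    then show ?thesis by (rule has_derivative_eq_rhs) (auto simp: algebra_simps)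
  qed
  moreover have "flat_algebra (\<lambda>x. ?f' x y)" for y
    by (intro flat_algebra.intros)
  ultimately show ?case by (intro exI[of _ ?f']) auto
next
  case (add f g)
  then obtain f' g' where "\<And>x. (f has_derivative f' x) (at x)" "\<And>h. flat_algebra (\<lambda>x. f' x h)"
    "\<And>x. (g has_derivative g' x) (at x)" "\<And>h. flat_algebra (\<lambda>x. g' x h)" by metis
  then show ?case
    by (intro exI[of _ "\<lambda>x h. f' x h + g' x h"])
      (auto intro!: flat_algebra.add has_derivative_add)
next
  case (mult f g)
  then obtain f' g' where "\<And>x. (f has_derivative f' x) (at x)" "\<And>h. flat_algebra (\<lambda>x. f' x h)"
    "\<And>x. (g has_derivative g' x) (at x)" "\<And>h. flat_algebra (\<lambda>x. g' x h)" by metis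
  then show ?case
    using mult.hyps
    by (intro exI[of _ "\<lambda>x h. f x * g' x h + f' x h * g x"])
      (auto intro!: flat_algebra.add flat_algebra.mult has_derivative_mult)
qed

lemma smooth_flat_algebra:
  assumes "flat_algebra f"
  shows "smooth f"
  using assms
proof (coinduction arbitrary: f)
  case smooth
  then obtain f' where f': "\<And>x. (f has_derivative f' x) (at x)" "\<And>h. flat_algebra (\<lambda>x. f' x h)"
    using flat_algebra_has_derivative by blast
  then have "frechet_derivative f (at x) = f' x" for x
    using frechet_derivative_at by metis
  with f' show ?case unfolding differentiable_def by auto
qed

lemma flat_algebra_prod:
  "finite I \<Longrightarrow> (\<And>i. i \<in> I \<Longrightarrow> flat_algebra (f i)) \<Longrightarrow> flat_algebra (\<lambda>x. \<Prod>i\<in>I. f i x)"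
  by (induction I rule: finite_induct) (auto intro: flat_algebra.intros)

lemma smooth_imp_continuous: "smooth f \<Longrightarrow> continuous_on UNIV f"
  by (auto elim: smooth.cases simp: continuous_on_eq_continuous_at differentiable_imp_continuous_within)

text \<open>Each coordinate contributes one step at either face of the box. The product is supported
  in the closed box and approximates the indicator of the open one, so no convolution is
  required.\<close>

definition box_bump :: "'a::euclidean_space \<Rightarrow> 'a \<Rightarrow> nat \<Rightarrow> 'a \<Rightarrow> real" where
  "box_bump a b n x =
     (\<Prod>e\<in>Basis. flat 0 (real (Suc n) * (x \<bullet> e - a \<bullet> e)) * flat 0 (real (Suc n) * (b \<bullet> e - x \<bullet> e)))"

lemma smooth_box_bump: "smooth (box_bump a b n)"
proof -
  have "flat_algebra (\<lambda>x. flat 0 (real (Suc n) * (x \<bullet> e - a \<bullet> e)) *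
      flat 0 (real (Suc n) * (b \<bullet> e - x \<bullet> e)))" for e
  proof (intro flat_algebra.mult)
    show "flat_algebra (\<lambda>x. flat 0 (real (Suc n) * (x \<bullet> e - a \<bullet> e)))"
      using flat_algebra.flat[of 0 "- real (Suc n) * (a \<bullet> e)" "real (Suc n) *\<^sub>R e"]
      by (simp add: algebra_simps)
    show "flat_algebra (\<lambda>x. flat 0 (real (Suc n) * (b \<bullet> e - x \<bullet> e)))"
      using flat_algebra.flat[of 0 "real (Suc n) * (b \<bullet> e)" "- real (Suc n) *\<^sub>R e"]
      by (simp add: algebra_simps)
  qed
  then have "flat_algebra (box_bump a b n)"
    unfolding box_bump_def by (intro flat_algebra_prod) auto
  then show ?thesis by (rule smooth_flat_algebra)
qed

lemma box_bump_bounds: "0 \<le> box_bump a b n x" "box_bump a b n x \<le> 1"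
  unfolding box_bump_def
  by (auto intro!: prod_nonneg prod_le_1 mult_nonneg_nonneg mult_le_one flat_0_bounds)

lemma box_bump_tendsto: "(\<lambda>n. box_bump a b n x) \<longlonglongrightarrow> indicator (box a b) x"
proof -
  have "(\<lambda>n. box_bump a b n x) \<longlonglongrightarrow>
      (\<Prod>e\<in>Basis. (if 0 < x \<bullet> e - a \<bullet> e then 1 else 0) * (if 0 < b \<bullet> e - x \<bullet> e then 1 else 0))"
    unfolding box_bump_def by (intro tendsto_prod tendsto_mult flat_0_scaled_tendsto)
  also have "(\<Prod>e\<in>Basis. (if 0 < x \<bullet> e - a \<bullet> e then 1 else 0) * (if 0 < b \<bullet> e - x \<bullet> e then 1 else 0 :: real))
      = indicator (box a b) x"
    by (cases "x \<in> box a b") (auto simp: mem_box intro!: prod.neutral)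
  finally show ?thesis .
qed

lemma box_bump_eq_0: "x \<notin> cbox a b \<Longrightarrow> box_bump a b n x = 0"
  unfolding box_bump_def by (force simp: mem_box flat_def mult_le_0_iff)

lemma test_function_box_bump: "cbox a b \<subseteq> \<Omega> \<Longrightarrow> test_function \<Omega> (box_bump a b n)"
  unfolding test_function_def using smooth_box_bump box_bump_eq_0 by (metis compact_cbox)

section \<open>The fundamental lemma of the calculus of variations\<close>

text \<open>Dynkin's pi-lambda argument: open boxes are stable under intersection and generate the
  Borel sets, while vanishing of the integral passes to complements and countable disjoint
  unions.\<close>

lemma set_integral_eq_0_borel:
  fixes f :: "'a::euclidean_space \<Rightarrow> real"
  assumes f: "integrable lebesgue f"
    and box: "\<And>a b. (LINT x:box a b|lebesgue. f x) = 0"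
    and A: "A \<in> sets borel"
  shows "(LINT x:A|lebesgue. f x) = 0"
proof -
  let ?G = "range (\<lambda>(a, b). box a b :: 'a set)"
  have si: "set_integrable lebesgue S f" if "S \<in> sets borel" for S
    unfolding set_integrable_def using that f by (intro integrable_mult_indicator) auto
  have borelI: "S \<in> sets borel" if "S \<in> sigma_sets UNIV ?G" for S
    using that by (simp add: borel_eq_box)
  \<comment> \<open>The complement step needs the integral over the whole space, which is the limit
    over growing boxes.\<close>
  have univ: "(LINT x:UNIV|lebesgue. f x) = 0"
  proof -
    let ?A = "\<lambda>n::nat. box (- (real n *\<^sub>R One)) (real n *\<^sub>R One) :: 'a set"
    have "incseq ?A"
      by (rule incseq_SucI) (auto simp: mem_box inner_left_distrib algebra_simps inner_sum_left_Basis; smt (verit))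
    moreover have "(\<Union>i. ?A i) = UNIV" by (rule UN_box_eq_UNIV)
    ultimately have "(\<lambda>i. LINT x:?A i|lebesgue. f x) \<longlonglongrightarrow> (LINT x:(\<Union>i. ?A i)|lebesgue. f x)"
      by (intro set_integral_cont_up) (auto intro: si)
    then show ?thesis using box \<open>(\<Union>i. ?A i) = UNIV\<close> by (simp add: LIMSEQ_const_iff)
  qed
  have "Int_stable ?G" by (auto simp: Int_stable_def box_Int_box)
  moreover have "?G \<subseteq> Pow UNIV" by auto
  moreover have "A \<in> sigma_sets UNIV ?G" using A unfolding borel_eq_box by simp
  ultimately show ?thesis
  proof (induction rule: sigma_sets_induct_disjoint)
    case (basic A)
    then show ?case using box by auto
  next
    case empty
    show ?case by (simp add: set_lebesgue_integral_def)
  next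
    case (compl A)
    note A = borelI[OF compl(1)]
    have "(LINT x:A \<union> (UNIV - A)|lebesgue. f x) =
        (LINT x:A|lebesgue. f x) + (LINT x:UNIV - A|lebesgue. f x)"
      using A by (intro set_integral_Un si) auto
    then show ?case using compl(2) univ by simp
  next
    case (union A)
    have "(LINT x:(\<Union>i. A i)|lebesgue. f x) = (\<Sum>i. (LINT x:A i|lebesgue. f x))"
    proof (rule lebesgue_integral_countable_add)
      have A: "A i \<in> sets borel" for i using union(2) borelI by blast
      then show "A i \<in> sets lebesgue" for i by simp
      show "A i \<inter> A j = {}" if "i \<noteq> j" for i j
        using union(1) that by (auto simp: disjoint_family_on_def)
      show "set_integrable lebesgue (\<Union> (range A)) f"
        using A by (intro si) auto
    qed
    then show ?case using union(3) by simp
  qed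
qed

text \<open>A Borel representative \<open>g\<close> of \<open>f\<close> moves the question to
  \<open>lborel\<close>, where a function whose integral over every Borel set vanishes is zero
  almost everywhere.\<close>

lemma AE_eq_0_if_box_integrals_eq_0:
  fixes f :: "'a::euclidean_space \<Rightarrow> real"
  assumes f: "integrable lebesgue f"
    and box: "\<And>a b. (LINT x:box a b|lebesgue. f x) = 0"
  shows "AE x in lebesgue. f x = 0"
proof -
  obtain g where [measurable]: "g \<in> borel_measurable lborel" and ae: "AE x in lborel. f x = g x"
    using completion_ex_borel_measurable_real[OF borel_measurable_integrable[OF f]] by auto
  have ae': "AE x in lebesgue. f x = g x"
    using ae by (rule AE_completion)
  have [measurable]: "f \<in> borel_measurable lebesgue" using f by simp
  have g_leb[measurable]: "g \<in> borel_measurable lebesgue"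
    by (rule measurable_completion) measurable
  have "integrable lebesgue g"
    using f ae' by (subst integrable_cong_AE[of g _ f]) auto
  then have "integrable lborel g"
    by (simp add: integrable_completion)
  then have "AE x in lborel. g x = 0"
  proof (rule sigma_finite_measure.density_zero[OF lborel.sigma_finite_measure_axioms])
    fix A :: "'a set"
    assume A: "A \<in> sets lborel"
    then have [measurable]: "A \<in> sets lebesgue" by simp
    have "(LINT x:A|lborel. g x) = (LINT x:A|lebesgue. g x)"
      unfolding set_lebesgue_integral_def using A by (intro integral_completion[symmetric]) auto
    also have "\<dots> = (LINT x:A|lebesgue. f x)"
      unfolding set_lebesgue_integral_def
      by (intro integral_cong_AE; (measurable; fail)?) (use ae' in \<open>auto elim: eventually_mono\<close>)
    also have "\<dots> = 0"
      using A by (intro set_integral_eq_0_borel[OF f box]) auto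
    finally show "(LINT x:A|lborel. g x) = 0" .
  qed
  with ae have "AE x in lborel. f x = 0" by eventually_elim auto
  then show ?thesis by (rule AE_completion)
qed

text \<open>Dominated convergence along the bumps gives zero integrals over boxes whose closed box
  lies in the domain. This settles each such box, and countably many of them cover the
  domain.\<close>

lemma fundamental_lemma_calculus_of_variations:
  fixes f :: "'a::euclidean_space \<Rightarrow> real"
  assumes \<Omega>: "open \<Omega>"
    and f: "integrable (lebesgue_on \<Omega>) f"
    and test: "\<And>\<phi>. test_function \<Omega> \<phi> \<Longrightarrow> (LINT x|lebesgue_on \<Omega>. f x * \<phi> x) = 0"
  shows "AE x in lebesgue_on \<Omega>. f x = 0"
proof -
  have \<Omega>_leb: "\<Omega> \<in> sets lebesgue" using \<Omega> by simp
  have box0: "(LINT x:box a b|lebesgue. indicator \<Omega> x * f x) = 0" if "cbox a b \<subseteq> \<Omega>" for a b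
  proof -
    have "(\<lambda>n. LINT x|lebesgue_on \<Omega>. f x * box_bump a b n x) \<longlonglongrightarrow>
        (LINT x|lebesgue_on \<Omega>. f x * indicator (box a b) x)"
    proof (rule integral_dominated_convergence[where w = "\<lambda>x. \<bar>f x\<bar>"])
      have [measurable]: "box_bump a b n \<in> borel_measurable (lebesgue_on \<Omega>)" for n
      proof -
        have "continuous_on UNIV (box_bump a b n)"
          by (rule smooth_imp_continuous[OF smooth_box_bump])
        then show ?thesis
          by (intro measurable_restrict_space1 measurable_completion)
            (simp add: borel_measurable_continuous_onI)
      qed
      have [measurable]: "f \<in> borel_measurable (lebesgue_on \<Omega>)"
        using f by (rule borel_measurable_integrable)
      show "(\<lambda>x. f x * box_bump a b n x) \<in> borel_measurable (lebesgue_on \<Omega>)" for n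
        by measurable
      have [measurable]: "(indicator (box a b) :: 'a \<Rightarrow> real) \<in> borel_measurable (lebesgue_on \<Omega>)"
        by (intro measurable_restrict_space1 borel_measurable_indicator) auto
      show "(\<lambda>x. f x * indicator (box a b) x) \<in> borel_measurable (lebesgue_on \<Omega>)"
        by measurable
      show "integrable (lebesgue_on \<Omega>) (\<lambda>x. \<bar>f x\<bar>)" using f by simp
      show "AE x in lebesgue_on \<Omega>. (\<lambda>n. f x * box_bump a b n x) \<longlonglongrightarrow> f x * indicator (box a b) x"
        by (intro AE_I2 tendsto_intros box_bump_tendsto)
      show "AE x in lebesgue_on \<Omega>. norm (f x * box_bump a b n x) \<le> \<bar>f x\<bar>" for n
        using box_bump_bounds[of a b n] by (auto simp: abs_mult mult_left_le)
    qed
    moreover have "(LINT x|lebesgue_on \<Omega>. f x * box_bump a b n x) = 0" for n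
      by (rule test[OF test_function_box_bump[OF that]])
    ultimately have "(LINT x|lebesgue_on \<Omega>. f x * indicator (box a b) x) = 0"
      by (simp add: LIMSEQ_const_iff)
    then show ?thesis
      using \<Omega>_leb by (simp add: integral_restrict_space set_lebesgue_integral_def mult_ac)
  qed
  have F: "integrable lebesgue (\<lambda>x. indicator \<Omega> x * f x)"
    using f \<Omega>_leb by (simp add: integrable_restrict_space)
  have ae_box: "AE x in lebesgue. x \<in> box a b \<longrightarrow> f x = 0" if ab: "cbox a b \<subseteq> \<Omega>" for a b
  proof -
    have "AE x in lebesgue. indicator (box a b) x *\<^sub>R (indicator \<Omega> x * f x) = 0"
    proof (rule AE_eq_0_if_box_integrals_eq_0)
      show "integrable lebesgue (\<lambda>x. indicator (box a b) x *\<^sub>R (indicator \<Omega> x * f x))"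
        by (intro integrable_mult_indicator F) auto
      fix c d
      \<comment> \<open>Localizing to one box makes the integral over an arbitrary box
        \<open>box c d\<close> an integral over a box that \<open>box0\<close> covers.\<close>
      obtain p q where pq: "box c d \<inter> box a b = box p q" "cbox p q \<subseteq> \<Omega>"
      proof (cases "box c d \<inter> box a b = {}")
        case True
        \<comment> \<open>An empty open box may have a nonempty degenerate closed box, so endpoints
          are chosen for which both are empty.\<close>
        moreover have "cbox (One :: 'a) 0 = {}" "box (One :: 'a) 0 = {}"
          using SOME_Basis by (force simp: box_eq_empty)+
        ultimately show ?thesis using that[of One 0] by simp
      next
        case False
        obtain p q where pq: "box c d \<inter> box a b = box p q" unfolding box_Int_box by blast
        then have "cbox p q = closure (box p q)" using False pq by (simp add: closure_box)
        also have "\<dots> \<subseteq> closure (box a b)" using pq by (intro closure_mono) auto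
        also have "\<dots> \<subseteq> cbox a b" by (intro closure_minimal box_subset_cbox closed_cbox)
        finally show ?thesis using that[OF pq] ab by blast
      qed
      have "(LINT x:box c d|lebesgue. indicator (box a b) x *\<^sub>R (indicator \<Omega> x * f x))
          = (LINT x:box p q|lebesgue. indicator \<Omega> x * f x)"
        unfolding set_lebesgue_integral_def pq(1)[symmetric]
        by (auto intro!: Bochner_Integration.integral_cong simp: indicator_def)
      also have "\<dots> = 0" by (rule box0[OF pq(2)])
      finally show "(LINT x:box c d|lebesgue. indicator (box a b) x *\<^sub>R (indicator \<Omega> x * f x)) = 0" .
    qed
    then show ?thesis
      by eventually_elim (use ab box_subset_cbox in \<open>fastforce simp: indicator_def\<close>)
  qed
  obtain \<D> where \<D>: "countable \<D>" "\<D> \<subseteq> Pow \<Omega>"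
      "\<And>X. X \<in> \<D> \<Longrightarrow> \<exists>a b. X = cbox a b" "\<Union>\<D> = \<Omega>"
    by (rule open_countable_Union_open_cbox[OF \<Omega>]) (rule that)
  have "AE x in lebesgue. x \<in> X \<longrightarrow> f x = 0" if mem: "X \<in> \<D>" for X
  proof -
    obtain a b where X: "X = cbox a b" using \<D>(3)[OF mem] by blast
    \<comment> \<open>The cover consists of closed boxes but the result holds on open ones; the
      faces in between are null.\<close>
    have "AE x in lebesgue. x \<notin> cbox a b - box a b"
      using negligible_frontier_interval[of a b] by (intro AE_not_in) (simp add: negligible_iff_null_sets)
    moreover have "AE x in lebesgue. x \<in> box a b \<longrightarrow> f x = 0"
      by (rule ae_box) (use mem \<D>(2) X in auto)
    ultimately show ?thesis
      by eventually_elim (simp add: X)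
  qed
  then have "AE x in lebesgue. \<forall>X\<in>\<D>. x \<in> X \<longrightarrow> f x = 0"
    using \<D>(1) by (intro AE_ball_countable[THEN iffD2]) auto
  then have "AE x in lebesgue. x \<in> \<Omega> \<longrightarrow> f x = 0"
    by eventually_elim (use \<D>(4) in blast)
  then show ?thesis using \<Omega>_leb by (simp add: AE_restrict_space_iff)
qed

section \<open>Weak gradients and the bilinear forms\<close>

lemma L2_bounded_linear:
  assumes T: "bounded_linear T" and f: "f \<in> L2 \<Omega>"
  shows "(\<lambda>x. T (f x)) \<in> L2 \<Omega>"
proof -
  obtain K where K: "\<And>x. norm (T x) \<le> norm x * K"
    using bounded_linear.bounded[OF T] by blast
  have [measurable]: "f \<in> borel_measurable (lebesgue_on \<Omega>)"
    using f by (simp add: L2_def)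
  have [measurable]: "T \<in> borel_measurable borel"
    using T by (simp add: borel_measurable_continuous_onI linear_continuous_on)
  have "integrable (lebesgue_on \<Omega>) (\<lambda>x. (norm (T (f x)))\<^sup>2)"
  proof (rule Bochner_Integration.integrable_bound)
    show "integrable (lebesgue_on \<Omega>) (\<lambda>x. K\<^sup>2 * (norm (f x))\<^sup>2)"
      using f by (simp add: L2_def)
    show "AE x in lebesgue_on \<Omega>. norm ((norm (T (f x)))\<^sup>2) \<le> norm (K\<^sup>2 * (norm (f x))\<^sup>2)"
      using power_mono[OF K norm_ge_zero, of _ 2] by (auto simp: power_mult_distrib mult.commute)
  qed measurable
  then show ?thesis by (simp add: L2_def)
qed

lemma L2_zero: "(\<lambda>_. 0) \<in> L2 \<Omega>"
  by (simp add: L2_def)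

lemma L2_scaleR: "f \<in> L2 \<Omega> \<Longrightarrow> (\<lambda>x. c *\<^sub>R f x) \<in> L2 \<Omega>"
  by (rule L2_bounded_linear) (rule bounded_linear_scaleR_right)

lemma L2_add:
  assumes "f \<in> L2 \<Omega>" "g \<in> L2 \<Omega>"
  shows "(\<lambda>x. f x + g x) \<in> L2 \<Omega>"
proof -
  have [measurable]: "f \<in> borel_measurable (lebesgue_on \<Omega>)" "g \<in> borel_measurable (lebesgue_on \<Omega>)"
    using assms by (auto simp: L2_def)
  have "integrable (lebesgue_on \<Omega>) (\<lambda>x. (norm (f x + g x))\<^sup>2)"
  proof (rule Bochner_Integration.integrable_bound)
    show "integrable (lebesgue_on \<Omega>) (\<lambda>x. 2 * (norm (f x))\<^sup>2 + 2 * (norm (g x))\<^sup>2)"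
      using assms by (simp add: L2_def)
    have "(norm (a + b))\<^sup>2 \<le> 2 * (norm a)\<^sup>2 + 2 * (norm b)\<^sup>2" for a b :: 'b
    proof -
      have "(norm (a + b))\<^sup>2 \<le> (norm a + norm b)\<^sup>2"
        by (intro power_mono norm_triangle_ineq) auto
      also have "\<dots> \<le> 2 * (norm a)\<^sup>2 + 2 * (norm b)\<^sup>2"
        using sum_squares_bound[of "norm a" "norm b"] by (simp add: power2_sum)
      finally show ?thesis .
    qed
    then show "AE x in lebesgue_on \<Omega>. norm ((norm (f x + g x))\<^sup>2) \<le>
        norm (2 * (norm (f x))\<^sup>2 + 2 * (norm (g x))\<^sup>2)"
      by auto
  qed measurable
  then show ?thesis by (simp add: L2_def)
qed

lemma L2_sum: "(\<And>i. i \<in> I \<Longrightarrow> f i \<in> L2 \<Omega>) \<Longrightarrow> (\<lambda>x. \<Sum>i\<in>I. f i x) \<in> L2 \<Omega>"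
  by (induction I rule: infinite_finite_induct) (auto intro: L2_zero L2_add)

lemma L2_indicator:
  assumes S: "S \<in> sets lebesgue" and f: "f \<in> L2 \<Omega>"
  shows "(\<lambda>x. indicator S x *\<^sub>R f x) \<in> L2 \<Omega>"
proof -
  have [measurable]: "f \<in> borel_measurable (lebesgue_on \<Omega>)"
    using f by (simp add: L2_def)
  have [measurable]: "(indicator S :: 'a \<Rightarrow> real) \<in> borel_measurable (lebesgue_on \<Omega>)"
    using S by (intro measurable_restrict_space1 borel_measurable_indicator)
  have "integrable (lebesgue_on \<Omega>) (\<lambda>x. (norm (indicator S x *\<^sub>R f x))\<^sup>2)"
  proof (rule Bochner_Integration.integrable_bound)
    show "integrable (lebesgue_on \<Omega>) (\<lambda>x. (norm (f x))\<^sup>2)"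
      using f by (simp add: L2_def)
  qed (measurable, auto simp: indicator_def)
  then show ?thesis by (simp add: L2_def)
qed

text \<open>Preimages under \<open>f\<close> and \<open>g\<close> differ by a negligible set, and
  Lebesgue measurability is complete. This handles tensor fields with arbitrary values on the
  interfaces.\<close>

lemma L2_spike:
  fixes f g :: "'a::euclidean_space \<Rightarrow> 'b::euclidean_space"
  assumes f: "f \<in> L2 \<Omega>" and \<Omega>: "\<Omega> \<in> sets lebesgue" and N: "negligible N"
    and eq: "\<And>x. x \<in> \<Omega> - N \<Longrightarrow> g x = f x"
  shows "g \<in> L2 \<Omega>"
proof -
  have f_meas: "f \<in> borel_measurable (lebesgue_on \<Omega>)"
    using f by (simp add: L2_def)
  have g_meas: "g \<in> borel_measurable (lebesgue_on \<Omega>)"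
  proof (rule measurableI)
    fix Y :: "'b set"
    assume "Y \<in> sets borel"
    then have F: "f -` Y \<inter> \<Omega> \<in> sets lebesgue"
      using measurable_sets[OF f_meas, of Y] \<Omega> by (auto simp: sets_restrict_space_iff)
    have "negligible ((f -` Y \<inter> \<Omega> - g -` Y \<inter> \<Omega>) \<union> (g -` Y \<inter> \<Omega> - f -` Y \<inter> \<Omega>))"
      by (rule negligible_subset[OF N]) (use eq in auto)
    then have "g -` Y \<inter> \<Omega> \<in> sets lebesgue"
      using F sets_negligible_symdiff by blast
    then show "g -` Y \<inter> space (lebesgue_on \<Omega>) \<in> sets (lebesgue_on \<Omega>)"
      using \<Omega> by (auto simp: sets_restrict_space_iff)
  qed simp
  have "AE x in lebesgue. x \<notin> N"
    using N by (intro AE_not_in) (simp add: negligible_iff_null_sets)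
  then have "AE x in lebesgue_on \<Omega>. (norm (f x))\<^sup>2 = (norm (g x))\<^sup>2"
    using \<Omega> by (auto simp: AE_restrict_space_iff eq elim: eventually_mono)
  then have "integrable (lebesgue_on \<Omega>) (\<lambda>x. (norm (g x))\<^sup>2)"
    using f f_meas g_meas by (subst integrable_cong_AE[of _ _ "\<lambda>x. (norm (f x))\<^sup>2"]) (auto simp: L2_def)
  with g_meas show ?thesis by (simp add: L2_def)
qed

lemma L2_inner_integrable:
  assumes "f \<in> L2 \<Omega>" "g \<in> L2 \<Omega>"
  shows "integrable (lebesgue_on \<Omega>) (\<lambda>x. f x \<bullet> g x)"
proof (rule Bochner_Integration.integrable_bound)
  have [measurable]: "f \<in> borel_measurable (lebesgue_on \<Omega>)" "g \<in> borel_measurable (lebesgue_on \<Omega>)"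
    using assms by (auto simp: L2_def)
  show "(\<lambda>x. f x \<bullet> g x) \<in> borel_measurable (lebesgue_on \<Omega>)" by measurable
  show "integrable (lebesgue_on \<Omega>) (\<lambda>x. (norm (f x))\<^sup>2 + (norm (g x))\<^sup>2)"
    using assms by (simp add: L2_def)
  have "\<bar>a \<bullet> b\<bar> \<le> (norm a)\<^sup>2 + (norm b)\<^sup>2" for a b :: 'b
  proof -
    have "0 \<le> norm a * norm b" by simp
    then show ?thesis
      using Cauchy_Schwarz_ineq2[of a b] sum_squares_bound[of "norm a" "norm b"] by linarith
  qed
  then show "AE x in lebesgue_on \<Omega>. norm (f x \<bullet> g x) \<le> norm ((norm (f x))\<^sup>2 + (norm (g x))\<^sup>2)"
    by auto
qed

text \<open>A bounded domain has finite measure, so \<open>1 + (norm (f x))\<^sup>2\<close> is an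
  integrable majorant.\<close>

lemma L2_integrable:
  assumes f: "f \<in> L2 \<Omega>" and \<Omega>: "bounded \<Omega>" "\<Omega> \<in> sets lebesgue"
  shows "integrable (lebesgue_on \<Omega>) f"
proof (rule Bochner_Integration.integrable_bound)
  have "\<Omega> \<in> lmeasurable" using \<Omega> by (simp add: bounded_set_imp_lmeasurable)
  then interpret finite_measure "lebesgue_on \<Omega>"
    by (rule finite_measure_lebesgue_on)
  show "integrable (lebesgue_on \<Omega>) (\<lambda>x. 1 + (norm (f x))\<^sup>2)"
    using f by (simp add: L2_def)
  have "norm a \<le> 1 + (norm a)\<^sup>2" for a :: 'b
  proof -
    have "2 * norm a \<le> (norm a)\<^sup>2 + 1"
      using sum_squares_bound[of "norm a" 1] by simp
    then show ?thesis using norm_ge_zero[of a] by linarith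
  qed
  then show "AE x in lebesgue_on \<Omega>. norm (f x) \<le> norm (1 + (norm (f x))\<^sup>2)"
    by (auto simp: add_nonneg_nonneg)
  show "f \<in> borel_measurable (lebesgue_on \<Omega>)" using f by (simp add: L2_def)
qed

text \<open>The complement of the compact set \<open>K\<close> is open and the function vanishes on
  it, so its derivative vanishes there too.\<close>

lemma test_function_frechet_derivative:
  assumes "test_function \<Omega> \<phi>"
  shows "test_function \<Omega> (\<lambda>x. frechet_derivative \<phi> (at x) h)"
proof -
  obtain K where K: "smooth \<phi>" "compact K" "K \<subseteq> \<Omega>" "\<And>x. x \<notin> K \<Longrightarrow> \<phi> x = 0"
    using assms by (auto simp: test_function_def)
  have "frechet_derivative \<phi> (at x) h = 0" if "x \<notin> K" for x
  proof -
    have "((\<lambda>_. 0) has_derivative (\<lambda>_. 0)) (at x)" by simp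
    then have "(\<phi> has_derivative (\<lambda>_. 0)) (at x)"
      by (rule has_derivative_transform_within_open[of _ _ _ _ "- K"])
        (use K that in \<open>auto simp: open_Compl compact_imp_closed\<close>)
    then show ?thesis by (metis frechet_derivative_at)
  qed
  moreover have "smooth (\<lambda>x. frechet_derivative \<phi> (at x) h)"
    using K(1) by (auto elim: smooth.cases)
  ultimately show ?thesis using K unfolding test_function_def by blast
qed

lemma integrable_mult_test_function:
  fixes f :: "'a::euclidean_space \<Rightarrow> real"
  assumes f: "integrable (lebesgue_on \<Omega>) f" and \<phi>: "test_function \<Omega> \<phi>"
  shows "integrable (lebesgue_on \<Omega>) (\<lambda>x. f x * \<phi> x)"
proof -
  obtain K where K: "smooth \<phi>" "compact K" "\<And>x. x \<notin> K \<Longrightarrow> \<phi> x = 0"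
    using \<phi> by (auto simp: test_function_def)
  have cont: "continuous_on UNIV \<phi>" using K(1) by (rule smooth_imp_continuous)
  then have "compact (\<phi> ` K)"
    using K(2) by (meson compact_continuous_image continuous_on_subset subset_UNIV)
  then obtain B where "\<And>x. x \<in> K \<Longrightarrow> norm (\<phi> x) \<le> B"
    using compact_imp_bounded by (metis bounded_iff imageI)
  then have B: "norm (\<phi> x) \<le> \<bar>B\<bar>" for x using K(3) by (cases "x \<in> K") force+
  have [measurable]: "\<phi> \<in> borel_measurable (lebesgue_on \<Omega>)"
    using cont by (intro measurable_restrict_space1 measurable_completion)
      (simp add: borel_measurable_continuous_onI)
  have [measurable]: "f \<in> borel_measurable (lebesgue_on \<Omega>)"
    using f by (rule borel_measurable_integrable)
  show ?thesis
  proof (rule Bochner_Integration.integrable_bound)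
    show "integrable (lebesgue_on \<Omega>) (\<lambda>x. \<bar>B\<bar> * f x)" using f by simp
    show "AE x in lebesgue_on \<Omega>. norm (f x * \<phi> x) \<le> norm (\<bar>B\<bar> * f x)"
      using B by (auto simp: abs_mult mult.commute intro!: mult_right_mono)
  qed measurable
qed

lemma H1_imp_L2: "v \<in> H1 \<Omega> \<Longrightarrow> v \<in> L2 \<Omega>"
  by (simp add: H1_def)

lemma linear_tensor_apply: "linear (tensor_apply T)"
  by (rule linearI)
    (auto simp: tensor_apply_def vec_eq_iff algebra_simps sum.distrib sum_distrib_left)

lemma weak_gradient_grad: "v \<in> H1 \<Omega> \<Longrightarrow> weak_gradient \<Omega> v (grad \<Omega> v)"
  unfolding H1_def grad_def by (auto intro: someI_ex[of "weak_gradient \<Omega> v"])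

section \<open>Calculus of weak gradients\<close>

context
  fixes \<Omega> :: "(real^'d) set"
  assumes \<Omega>: "open \<Omega>" "bounded \<Omega>"
begin

lemma L2_component_integrable:
  fixes v :: "real^'d \<Rightarrow> real^'d"
  assumes "v \<in> L2 \<Omega>"
  shows "integrable (lebesgue_on \<Omega>) (\<lambda>x. v x $ i)"
  using L2_integrable[OF assms] \<Omega> by (intro integrable_bounded_linear[OF bounded_linear_vec_nth]) simp

lemma L2_matrix_component_integrable:
  fixes G :: "real^'d \<Rightarrow> real^'d^'d"
  assumes "G \<in> L2 \<Omega>"
  shows "integrable (lebesgue_on \<Omega>) (\<lambda>x. G x $ i $ j)"
  using L2_integrable[OF assms] \<Omega>
  by (intro integrable_bounded_linear[OF bounded_linear_vec_nth]) simp

lemma weak_gradient_zero: "weak_gradient \<Omega> (\<lambda>_. 0) (\<lambda>_. 0)"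
  by (simp add: weak_gradient_def L2_zero)

lemma weak_gradient_add:
  assumes "v \<in> L2 \<Omega>" "w \<in> L2 \<Omega>" "weak_gradient \<Omega> v G" "weak_gradient \<Omega> w H"
  shows "weak_gradient \<Omega> (\<lambda>x. v x + w x) (\<lambda>x. G x + H x)"
  using assms unfolding weak_gradient_def
  by (auto simp: L2_add distrib_right L2_component_integrable L2_matrix_component_integrable
      integrable_mult_test_function test_function_frechet_derivative)

lemma weak_gradient_scaleR:
  assumes "weak_gradient \<Omega> v G"
  shows "weak_gradient \<Omega> (\<lambda>x. c *\<^sub>R v x) (\<lambda>x. c *\<^sub>R G x)"
  using assms unfolding weak_gradient_def by (auto simp: L2_scaleR mult.assoc)

text \<open>The defining identity sees \<open>v\<close> only under an integral. Together with
  uniqueness this makes strains depend only on almost-everywhere classes.\<close>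

lemma weak_gradient_cong_AE:
  assumes "v \<in> L2 \<Omega>" "w \<in> L2 \<Omega>" "AE x in lebesgue_on \<Omega>. v x = w x" "weak_gradient \<Omega> v G"
  shows "weak_gradient \<Omega> w G"
  unfolding weak_gradient_def
proof (intro conjI allI impI)
  show "G \<in> L2 \<Omega>" using assms by (simp add: weak_gradient_def)
  fix \<phi> i j
  assume \<phi>: "test_function \<Omega> \<phi>"
  have int: "integrable (lebesgue_on \<Omega>) (\<lambda>x. u x $ i * frechet_derivative \<phi> (at x) (axis j 1))"
    if "u \<in> L2 \<Omega>" for u :: "real^'d \<Rightarrow> real^'d"
    using that \<phi>
    by (intro integrable_mult_test_function L2_component_integrable test_function_frechet_derivative)
  have "(LINT x|lebesgue_on \<Omega>. w x $ i * frechet_derivative \<phi> (at x) (axis j 1)) =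
      (LINT x|lebesgue_on \<Omega>. v x $ i * frechet_derivative \<phi> (at x) (axis j 1))"
    using assms(3) borel_measurable_integrable[OF int[OF assms(1)]]
      borel_measurable_integrable[OF int[OF assms(2)]]
    by (intro integral_cong_AE) (auto elim: eventually_mono)
  also have "\<dots> = - (LINT x|lebesgue_on \<Omega>. G x $ i $ j * \<phi> x)"
    using assms(4) \<phi> by (simp add: weak_gradient_def)
  finally show "(LINT x|lebesgue_on \<Omega>. w x $ i * frechet_derivative \<phi> (at x) (axis j 1)) =
      - (LINT x|lebesgue_on \<Omega>. G x $ i $ j * \<phi> x)" .
qed

text \<open>Each entry of \<open>G - H\<close> integrates to zero against every test function, so
  the fundamental lemma applies entry by entry.\<close>

lemma weak_gradient_unique:
  assumes "weak_gradient \<Omega> v G" "weak_gradient \<Omega> v H"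
  shows "AE x in lebesgue_on \<Omega>. G x = H x"
proof -
  have int: "integrable (lebesgue_on \<Omega>) (\<lambda>x. G x $ i $ j)"
    "integrable (lebesgue_on \<Omega>) (\<lambda>x. H x $ i $ j)" for i j
    using assms by (auto simp: weak_gradient_def L2_matrix_component_integrable)
  have "AE x in lebesgue_on \<Omega>. G x $ i $ j - H x $ i $ j = 0" for i j
  proof (rule fundamental_lemma_calculus_of_variations[OF \<Omega>(1)])
    show "integrable (lebesgue_on \<Omega>) (\<lambda>x. G x $ i $ j - H x $ i $ j)" using int by simp
    fix \<phi> assume \<phi>: "test_function \<Omega> \<phi>"
    have "(LINT x|lebesgue_on \<Omega>. G x $ i $ j * \<phi> x) = (LINT x|lebesgue_on \<Omega>. H x $ i $ j * \<phi> x)"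
    proof -
      have "- (LINT x|lebesgue_on \<Omega>. G x $ i $ j * \<phi> x) =
          (LINT x|lebesgue_on \<Omega>. v x $ i * frechet_derivative \<phi> (at x) (axis j 1))"
        "- (LINT x|lebesgue_on \<Omega>. H x $ i $ j * \<phi> x) =
          (LINT x|lebesgue_on \<Omega>. v x $ i * frechet_derivative \<phi> (at x) (axis j 1))"
        using assms \<phi> by (simp_all add: weak_gradient_def)
      then show ?thesis by linarith
    qed
    then show "(LINT x|lebesgue_on \<Omega>. (G x $ i $ j - H x $ i $ j) * \<phi> x) = 0"
      using int \<phi> by (simp add: left_diff_distrib integrable_mult_test_function)
  qed
  then have "AE x in lebesgue_on \<Omega>. \<forall>i j. G x $ i $ j - H x $ i $ j = 0"
    by (simp add: AE_all_countable)
  then show ?thesis by eventually_elim (simp add: vec_eq_iff)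
qed

text \<open>This tames the arbitrary choice in \<open>grad\<close>: any weak gradient at hand may
  replace it almost everywhere.\<close>

lemma AE_grad_eqI:
  assumes "weak_gradient \<Omega> v G"
  shows "AE x in lebesgue_on \<Omega>. grad \<Omega> v x = G x"
  unfolding grad_def
  by (rule weak_gradient_unique[OF someI[of "weak_gradient \<Omega> v", OF assms] assms])

lemma H1_zero: "(\<lambda>_. 0) \<in> H1 \<Omega>"
  using weak_gradient_zero by (auto simp: H1_def L2_zero)

lemma H1_add: "v \<in> H1 \<Omega> \<Longrightarrow> w \<in> H1 \<Omega> \<Longrightarrow> (\<lambda>x. v x + w x) \<in> H1 \<Omega>"
  using weak_gradient_add unfolding H1_def by (blast intro: L2_add)

lemma H1_scaleR: "v \<in> H1 \<Omega> \<Longrightarrow> (\<lambda>x. c *\<^sub>R v x) \<in> H1 \<Omega>"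
  using weak_gradient_scaleR unfolding H1_def by (blast intro: L2_scaleR)

lemma H1_sum: "(\<And>i. i \<in> I \<Longrightarrow> f i \<in> H1 \<Omega>) \<Longrightarrow> (\<lambda>x. \<Sum>i\<in>I. f i x) \<in> H1 \<Omega>"
  by (induction I rule: infinite_finite_induct) (auto intro: H1_zero H1_add)

lemma AE_strain_add:
  assumes "v \<in> H1 \<Omega>" "w \<in> H1 \<Omega>"
  shows "AE x in lebesgue_on \<Omega>. strain \<Omega> (\<lambda>x. v x + w x) x = strain \<Omega> v x + strain \<Omega> w x"
  using AE_grad_eqI[OF weak_gradient_add[OF H1_imp_L2 H1_imp_L2 weak_gradient_grad weak_gradient_grad,
        OF assms assms]]
  by eventually_elim (simp add: strain_def transpose_def vec_eq_iff algebra_simps)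

lemma AE_strain_scaleR:
  assumes "v \<in> H1 \<Omega>"
  shows "AE x in lebesgue_on \<Omega>. strain \<Omega> (\<lambda>x. c *\<^sub>R v x) x = c *\<^sub>R strain \<Omega> v x"
  using AE_grad_eqI[OF weak_gradient_scaleR[OF weak_gradient_grad[OF assms]], of c]
  by eventually_elim (simp add: strain_def transpose_def vec_eq_iff algebra_simps)

lemma AE_strain_cong:
  assumes "v \<in> H1 \<Omega>" "w \<in> H1 \<Omega>" "AE x in lebesgue_on \<Omega>. v x = w x"
  shows "AE x in lebesgue_on \<Omega>. strain \<Omega> v x = strain \<Omega> w x"
  using weak_gradient_unique[OF weak_gradient_cong_AE[OF H1_imp_L2 H1_imp_L2 _ weak_gradient_grad]
      weak_gradient_grad, OF assms assms(1,2)]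
  by eventually_elim (simp add: strain_def)

lemma strain_L2:
  assumes "v \<in> H1 \<Omega>"
  shows "strain \<Omega> v \<in> L2 \<Omega>"
proof -
  let ?T = "\<lambda>E :: real^'d^'d. (1 / 2) *\<^sub>R (E + transpose E)"
  have "linear ?T"
    by (rule linearI) (auto simp: transpose_def vec_eq_iff algebra_simps)
  then have "bounded_linear ?T" by (simp add: linear_conv_bounded_linear)
  then have "(\<lambda>x. ?T (grad \<Omega> v x)) \<in> L2 \<Omega>"
    by (rule L2_bounded_linear) (use weak_gradient_grad[OF assms] in \<open>simp add: weak_gradient_def\<close>)
  then show ?thesis by (simp add: strain_def[abs_def])
qed

section \<open>The energy form\<close>

context
  fixes D and C :: "real^'d \<Rightarrow> real^'d^'d^'d^'d"
  assumes D: "nonoverlapping_decomposition \<Omega> D" and C: "hooke_tensor_field D C"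
begin

text \<open>Off the null set of interfaces the field is a finite sum of constant tensors times
  indicators of open sets, which yields measurability and integrability together.\<close>

lemma tensor_field_L2:
  assumes E: "E \<in> L2 \<Omega>"
  shows "(\<lambda>x. tensor_apply (C x) (E x)) \<in> L2 \<Omega>"
proof (rule L2_spike)
  \<comment> \<open>The tensor on a piece is read off at an arbitrary point of it; constancy on the
    piece makes the choice harmless.\<close>
  define c where "c S = C (SOME x. x \<in> S)" for S
  let ?F = "\<lambda>x. \<Sum>S\<in>D. indicator S x *\<^sub>R tensor_apply (c S) (E x)"
  have fin: "finite D" and opn: "\<And>S. S \<in> D \<Longrightarrow> open S" and disj: "pairwise disjnt D"
    using D by (auto simp: nonoverlapping_decomposition_def)
  have "bounded_linear (tensor_apply T)" for T :: "real^'d^'d^'d^'d"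
    using linear_tensor_apply by (simp add: linear_conv_bounded_linear)
  then show "?F \<in> L2 \<Omega>"
    using L2_bounded_linear[OF _ E] by (intro L2_sum L2_indicator) (auto simp: opn)
  show "\<Omega> \<in> sets lebesgue" using \<Omega> by simp
  show "negligible (\<Omega> - \<Union>D)" using D by (simp add: nonoverlapping_decomposition_def)
  fix x assume "x \<in> \<Omega> - (\<Omega> - \<Union>D)"
  then obtain S where S: "S \<in> D" "x \<in> S" by blast
  have "C constant_on S" using C S by (auto simp: hooke_tensor_field_def)
  then have cS: "C x = c S" unfolding c_def constant_on_def using S(2) by (metis someI)
  have "indicator S' x *\<^sub>R tensor_apply (c S') (E x) = (if S' = S then tensor_apply (c S) (E x) else 0)"
    if "S' \<in> D" for S'
    using disj S that by (auto simp: indicator_def pairwise_def disjnt_def)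
  then have "?F x = (\<Sum>S'\<in>D. if S' = S then tensor_apply (c S) (E x) else 0)"
    by (intro sum.cong) auto
  also have "\<dots> = tensor_apply (C x) (E x)" using fin S(1) cS by simp
  finally show "tensor_apply (C x) (E x) = ?F x" by simp
qed

lemma a_form_integrable:
  assumes "v \<in> H1 \<Omega>" "z \<in> H1 \<Omega>"
  shows "integrable (lebesgue_on \<Omega>) (\<lambda>x. tensor_apply (C x) (strain \<Omega> v x) \<bullet> strain \<Omega> z x)"
  using assms by (intro L2_inner_integrable tensor_field_L2 strain_L2)

lemma a_form_add_left:
  assumes v: "v \<in> H1 \<Omega>" and w: "w \<in> H1 \<Omega>" and z: "z \<in> H1 \<Omega>"
  shows "a_form \<Omega> C (\<lambda>x. v x + w x) z = a_form \<Omega> C v z + a_form \<Omega> C w z"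
proof -
  note int = a_form_integrable[OF _ z]
  have "a_form \<Omega> C (\<lambda>x. v x + w x) z = (LINT x|lebesgue_on \<Omega>.
      tensor_apply (C x) (strain \<Omega> v x) \<bullet> strain \<Omega> z x + tensor_apply (C x) (strain \<Omega> w x) \<bullet> strain \<Omega> z x)"
    unfolding a_form_def
  proof (rule integral_cong_AE)
    show "AE x in lebesgue_on \<Omega>. tensor_apply (C x) (strain \<Omega> (\<lambda>x. v x + w x) x) \<bullet> strain \<Omega> z x =
      tensor_apply (C x) (strain \<Omega> v x) \<bullet> strain \<Omega> z x + tensor_apply (C x) (strain \<Omega> w x) \<bullet> strain \<Omega> z x"
      using AE_strain_add[OF v w]
      by eventually_elim (simp add: linear_add[OF linear_tensor_apply] inner_add_left)
  qed (use int v w in \<open>auto intro!: H1_add borel_measurable_integrable\<close>)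
  then show ?thesis using int v w by (simp add: a_form_def)
qed

lemma a_form_scaleR_left:
  assumes v: "v \<in> H1 \<Omega>" and z: "z \<in> H1 \<Omega>"
  shows "a_form \<Omega> C (\<lambda>x. c *\<^sub>R v x) z = c * a_form \<Omega> C v z"
proof -
  note int = a_form_integrable[OF _ z]
  have "a_form \<Omega> C (\<lambda>x. c *\<^sub>R v x) z = (LINT x|lebesgue_on \<Omega>.
      c * (tensor_apply (C x) (strain \<Omega> v x) \<bullet> strain \<Omega> z x))"
    unfolding a_form_def
  proof (rule integral_cong_AE)
    show "AE x in lebesgue_on \<Omega>. tensor_apply (C x) (strain \<Omega> (\<lambda>x. c *\<^sub>R v x) x) \<bullet> strain \<Omega> z x =
      c * (tensor_apply (C x) (strain \<Omega> v x) \<bullet> strain \<Omega> z x)"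
      using AE_strain_scaleR[OF v, of c]
      by eventually_elim (simp add: linear_cmul[OF linear_tensor_apply])
  qed (use int v in \<open>auto intro!: H1_scaleR borel_measurable_integrable\<close>)
  then show ?thesis by (simp add: a_form_def)
qed

lemma a_form_cong_left:
  assumes v: "v \<in> H1 \<Omega>" and w: "w \<in> H1 \<Omega>" and z: "z \<in> H1 \<Omega>"
    and eq: "AE x in lebesgue_on \<Omega>. v x = w x"
  shows "a_form \<Omega> C v z = a_form \<Omega> C w z"
  unfolding a_form_def
proof (rule integral_cong_AE)
  show "AE x in lebesgue_on \<Omega>. tensor_apply (C x) (strain \<Omega> v x) \<bullet> strain \<Omega> z x =
      tensor_apply (C x) (strain \<Omega> w x) \<bullet> strain \<Omega> z x"
    using AE_strain_cong[OF v w eq] by eventually_elim simp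
qed (use a_form_integrable[OF _ z] v w in \<open>auto intro!: borel_measurable_integrable\<close>)

text \<open>Expanding the first argument is the form needed later: the eigenvalue equation then
  evaluates each term.\<close>

lemma a_form_sum_left:
  assumes "\<And>i. i \<in> I \<Longrightarrow> f i \<in> H1 \<Omega>" "z \<in> H1 \<Omega>"
  shows "a_form \<Omega> C (\<lambda>x. \<Sum>i\<in>I. c i *\<^sub>R f i x) z = (\<Sum>i\<in>I. c i * a_form \<Omega> C (f i) z)"
  using assms
proof (induction I rule: infinite_finite_induct)
  case empty
  \<comment> \<open>The chosen gradient of the zero function need not vanish pointwise, so the value
    0 comes from homogeneity with the factor 0.\<close>
  show ?case using a_form_scaleR_left[OF H1_zero \<open>z \<in> H1 \<Omega>\<close>, of 0] by simp
next
  case (infinite I)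
  show ?case using a_form_scaleR_left[OF H1_zero \<open>z \<in> H1 \<Omega>\<close>, of 0] infinite(1) by simp
next
  case (insert i I)
  then show ?case
    by (simp add: a_form_add_left a_form_scaleR_left H1_sum H1_scaleR)
qed

end

end

section \<open>The mass form\<close>

lemma m_form_commute: "m_form \<Omega> v w = m_form \<Omega> w v"
  by (simp add: m_form_def inner_commute)

lemma m_form_cong_left:
  assumes "v \<in> L2 \<Omega>" "w \<in> L2 \<Omega>" "z \<in> L2 \<Omega>" "AE x in lebesgue_on \<Omega>. v x = w x"
  shows "m_form \<Omega> v z = m_form \<Omega> w z"
  unfolding m_form_def using assms
  by (intro integral_cong_AE)
    (auto intro!: borel_measurable_integrable L2_inner_integrable elim: eventually_mono)

lemma m_form_sum_left:
  assumes "\<And>i. i \<in> I \<Longrightarrow> f i \<in> L2 \<Omega>" "z \<in> L2 \<Omega>"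
  shows "m_form \<Omega> (\<lambda>x. \<Sum>i\<in>I. c i *\<^sub>R f i x) z = (\<Sum>i\<in>I. c i * m_form \<Omega> (f i) z)"
  using assms by (simp add: m_form_def inner_sum_left L2_inner_integrable)

lemma m_form_self_eq_0_iff:
  assumes "v \<in> L2 \<Omega>"
  shows "m_form \<Omega> v v = 0 \<longleftrightarrow> ae_zero \<Omega> v"
  unfolding m_form_def ae_zero_def
  using L2_inner_integrable[OF assms assms] by (subst integral_nonneg_eq_0_iff_AE) auto

section \<open>Estimates in eigenbasis coordinates\<close>

text \<open>Gaussian elimination with more unknowns than equations: a pivot unknown removes one
  equation and one unknown, and the induction solves the rest.\<close>

lemma homogeneous_system_nontrivial_solution:
  fixes A :: "'i \<Rightarrow> nat \<Rightarrow> real"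
  assumes "finite I" "n < card I"
  shows "\<exists>\<beta>. (\<exists>i\<in>I. \<beta> i \<noteq> 0) \<and> (\<forall>l<n. (\<Sum>i\<in>I. \<beta> i * A i l) = 0)"
  using assms
proof (induction n arbitrary: I A)
  case 0
  then have "I \<noteq> {}" by auto
  then show ?case by (intro exI[of _ "\<lambda>_. 1"]) auto
next
  case (Suc n)
  show ?case
  proof (cases "\<forall>i\<in>I. A i n = 0")
    case True
    obtain \<beta> where "\<exists>i\<in>I. \<beta> i \<noteq> 0" "\<forall>l<n. (\<Sum>i\<in>I. \<beta> i * A i l) = 0"
      using Suc.IH[of I A] Suc.prems by auto
    with True show ?thesis by (intro exI[of _ \<beta>]) (auto simp: less_Suc_eq)
  next
    case False
    then obtain p where p: "p \<in> I" "A p n \<noteq> 0" by blast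
    define J where "J = I - {p}"
    have I: "I = insert p J" "p \<notin> J" "finite J" using p Suc.prems by (auto simp: J_def)
    then have "n < card J" using Suc.prems by simp
    then obtain \<gamma> where \<gamma>: "\<exists>i\<in>J. \<gamma> i \<noteq> 0"
      "\<forall>l<n. (\<Sum>i\<in>J. \<gamma> i * (A i l - A i n / A p n * A p l)) = 0"
      using Suc.IH[of J "\<lambda>i l. A i l - A i n / A p n * A p l"] I by auto
    \<comment> \<open>The value at the pivot \<open>p\<close> solves equation \<open>n\<close>;
      substituting it into the others gives exactly the reduced coefficients.\<close>
    define \<beta> where "\<beta> = \<gamma>(p := - (\<Sum>i\<in>J. \<gamma> i * A i n / A p n))"
    have "(\<Sum>i\<in>I. \<beta> i * A i l) = (\<Sum>i\<in>J. \<gamma> i * (A i l - A i n / A p n * A p l))" for l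
    proof -
      have "(\<Sum>i\<in>I. \<beta> i * A i l) = \<beta> p * A p l + (\<Sum>i\<in>J. \<gamma> i * A i l)"
        using I by (auto simp: \<beta>_def intro!: sum.cong)
      also have "\<dots> = (\<Sum>i\<in>J. \<gamma> i * (A i l - A i n / A p n * A p l))"
        by (simp add: \<beta>_def sum_distrib_right right_diff_distrib sum_subtractf mult.assoc)
      finally show ?thesis .
    qed
    moreover have "(\<Sum>i\<in>J. \<gamma> i * (A i n - A i n / A p n * A p n)) = 0" using p by simp
    moreover have "\<exists>i\<in>I. \<beta> i \<noteq> 0" using \<gamma>(1) I by (auto simp: \<beta>_def)
    ultimately show ?thesis using \<gamma>(2) by (intro exI[of _ \<beta>]) (auto simp: less_Suc_eq)
  qed
qed

text \<open>
  \<open>x t l\<close> is the \<open>l\<close>-th coordinate, in the detailed eigenbasis, of the \<open>t\<close>-th reduced eigenfunction.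
  Some combination of the first \<open>s\<close> reduced eigenfunctions is orthogonal to the first \<open>s - 1\<close> detailed ones.
\<close>

lemma ritz_value_ge_eigenvalue:
  fixes lam \<theta> :: "nat \<Rightarrow> real" and x :: "nat \<Rightarrow> nat \<Rightarrow> real"
  assumes lam: "mono_on {1..n} lam" and \<theta>: "mono_on {1..s} \<theta>" and s: "s \<in> {1..n}"
    and orth: "\<And>t t'. t \<in> {1..s} \<Longrightarrow> t' \<in> {1..s} \<Longrightarrow>
        (\<Sum>l=1..n. x t l * x t' l) = (if t = t' then 1 else 0)"
    and diag: "\<And>t t'. t \<in> {1..s} \<Longrightarrow> t' \<in> {1..s} \<Longrightarrow>
        (\<Sum>l=1..n. lam l * x t l * x t' l) = (if t = t' then \<theta> t else 0)"
  shows "lam s \<le> \<theta> s"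
proof -
  \<comment> \<open>There are \<open>s\<close> unknowns against \<open>s - 1\<close> orthogonality
    conditions. \<open>Suc l\<close> aligns equations counted from 0 with eigenfunctions counted
    from 1.\<close>
  have "s - 1 < card {1..s}" using s by simp
  then obtain \<beta> where \<beta>: "\<exists>t\<in>{1..s}. \<beta> t \<noteq> 0"
      "\<forall>l<s - 1. (\<Sum>t=1..s. \<beta> t * x t (Suc l)) = 0"
    using homogeneous_system_nontrivial_solution[of "{1..s}" "s - 1" "\<lambda>t l. x t (Suc l)"] by auto
  define y where "y l = (\<Sum>t=1..s. \<beta> t * x t l)" for l
  have y0: "y l = 0" if "l \<in> {1..<s}" for l
    using \<beta>(2)[rule_format, of "l - 1"] that by (auto simp: y_def)
  \<comment> \<open>The weight \<open>g\<close> serves two cases: the constant 1 gives the mass of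
    the combination and \<open>lam\<close> gives its energy.\<close>
  have expand: "(\<Sum>l=1..n. g l * (y l)\<^sup>2) =
      (\<Sum>t=1..s. \<Sum>t'=1..s. \<beta> t * \<beta> t' * (\<Sum>l=1..n. g l * x t l * x t' l))" for g :: "nat \<Rightarrow> real"
  proof -
    have "(\<Sum>l=1..n. g l * (y l)\<^sup>2) =
        (\<Sum>l=1..n. \<Sum>t=1..s. \<Sum>t'=1..s. \<beta> t * \<beta> t' * (g l * x t l * x t' l))"
      by (simp add: y_def power2_eq_square sum_product sum_distrib_left mult_ac)
    also have "\<dots> = (\<Sum>t=1..s. \<Sum>l=1..n. \<Sum>t'=1..s. \<beta> t * \<beta> t' * (g l * x t l * x t' l))"
      by (rule sum.swap)
    also have "\<dots> = (\<Sum>t=1..s. \<Sum>t'=1..s. \<Sum>l=1..n. \<beta> t * \<beta> t' * (g l * x t l * x t' l))"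
      by (intro sum.cong sum.swap refl)
    finally show ?thesis by (simp add: sum_distrib_left)
  qed
  have norm: "(\<Sum>l=1..n. (y l)\<^sup>2) = (\<Sum>t=1..s. (\<beta> t)\<^sup>2)"
  proof -
    have "(\<Sum>l=1..n. (y l)\<^sup>2) = (\<Sum>t=1..s. \<Sum>t'=1..s. \<beta> t * \<beta> t' * (if t = t' then 1 else 0))"
      using expand[of "\<lambda>_. 1"] by (simp add: orth cong: sum.cong_simp del: One_nat_def)
    also have "\<dots> = (\<Sum>t=1..s. (\<beta> t)\<^sup>2)"
      by (simp add: power2_eq_square if_distrib[of "(*) _"] sum.delta cong: if_cong)
    finally show ?thesis .
  qed
  have energy: "(\<Sum>l=1..n. lam l * (y l)\<^sup>2) = (\<Sum>t=1..s. \<theta> t * (\<beta> t)\<^sup>2)"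
  proof -
    have "(\<Sum>l=1..n. lam l * (y l)\<^sup>2) =
        (\<Sum>t=1..s. \<Sum>t'=1..s. \<beta> t * \<beta> t' * (if t = t' then \<theta> t else 0))"
      using expand[of lam] by (simp add: diag cong: sum.cong_simp del: One_nat_def)
    also have "\<dots> = (\<Sum>t=1..s. \<theta> t * (\<beta> t)\<^sup>2)"
      by (simp add: power2_eq_square if_distrib[of "(*) _"] sum.delta mult_ac cong: if_cong)
    finally show ?thesis .
  qed
  obtain t0 where t0: "t0 \<in> {1..s}" "\<beta> t0 \<noteq> 0" using \<beta>(1) by blast
  have pos: "0 < (\<Sum>t=1..s. (\<beta> t)\<^sup>2)"
    by (rule sum_pos2[of _ t0]) (use t0 in auto)
  \<comment> \<open>The energy of \<open>y\<close> is at least \<open>lam s\<close> times its mass,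
    as its coordinates below \<open>s\<close> vanish, and at most \<open>\<theta> s\<close> times
    its mass. The mass is positive and cancels.\<close>
  have "lam s * (\<Sum>t=1..s. (\<beta> t)\<^sup>2) = (\<Sum>l=1..n. lam s * (y l)\<^sup>2)"
    unfolding norm[symmetric] by (rule sum_distrib_left)
  also have "\<dots> \<le> (\<Sum>l=1..n. lam l * (y l)\<^sup>2)"
  proof (rule sum_mono)
    fix l assume l: "l \<in> {1..n}"
    show "lam s * (y l)\<^sup>2 \<le> lam l * (y l)\<^sup>2"
    proof (cases "l < s")
      case True
      then show ?thesis using y0[of l] l by simp
    next
      case False
      then have "lam s \<le> lam l" using lam l s by (intro mono_onD[OF lam]) auto
      then show ?thesis by (intro mult_right_mono) auto
    qed
  qed
  also have "\<dots> = (\<Sum>t=1..s. \<theta> t * (\<beta> t)\<^sup>2)" by (rule energy)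
  also have "\<dots> \<le> (\<Sum>t=1..s. \<theta> s * (\<beta> t)\<^sup>2)"
    by (intro sum_mono mult_right_mono mono_onD[OF \<theta>]) auto
  also have "\<dots> = \<theta> s * (\<Sum>t=1..s. (\<beta> t)\<^sup>2)" by (simp add: sum_distrib_left)
  finally show ?thesis using pos by simp
qed

text \<open>The arithmetic core, free of function spaces. An inequality for \<open>R\<close>
  suffices, so the dual norm only has to be bounded from below.\<close>

lemma spectral_gap_bound:
  fixes lam c :: "nat \<Rightarrow> real"
  assumes lam: "\<And>l. l \<in> {1..n} \<Longrightarrow> 0 < lam l"
    and low: "\<And>l. l \<in> {1..K} \<Longrightarrow> lam l \<le> \<kappa>" and high: "\<And>l. l \<in> {K<..n} \<Longrightarrow> \<kappa> \<le> lam l"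
    and K: "K < n" and \<kappa>: "0 < \<kappa>" "\<kappa> \<le> \<theta>"
    and norm: "(\<Sum>l=1..n. (c l)\<^sup>2) = 1" and energy: "(\<Sum>l=1..n. lam l * (c l)\<^sup>2) = \<theta>"
    and R: "(\<Sum>l=1..n. (c l)\<^sup>2 * (lam l - \<theta>)\<^sup>2 / lam l) \<le> R\<^sup>2" "0 \<le> R"
    and d: "0 < d" "\<And>l. l \<in> {K<..n} \<Longrightarrow> d \<le> \<bar>(lam l - \<theta>) / lam l\<bar>"
  shows "\<theta> - \<kappa> \<le> R\<^sup>2 / d * (1 + R / (d\<^sup>2 * sqrt \<kappa>))"
proof -
  have split: "{1..n} = {1..K} \<union> {K<..n}" "{1..K} \<inter> {K<..n} = {}" using K by auto
  have pos: "0 < lam l" if "l \<in> {K<..n}" for l using lam that by auto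
  have gap: "d * lam l \<le> \<bar>lam l - \<theta>\<bar>" if "l \<in> {K<..n}" for l
    using d(2)[OF that] pos[OF that] by (simp add: pos_le_divide_eq abs_divide)
  define \<beta> where "\<beta> = (\<Sum>l\<in>{K<..n}. (c l)\<^sup>2)"
  have R_tail: "(\<Sum>l\<in>{K<..n}. (c l)\<^sup>2 * (lam l - \<theta>)\<^sup>2 / lam l) \<le> R\<^sup>2"
  proof -
    have "(\<Sum>l\<in>{K<..n}. (c l)\<^sup>2 * (lam l - \<theta>)\<^sup>2 / lam l) \<le> (\<Sum>l=1..n. (c l)\<^sup>2 * (lam l - \<theta>)\<^sup>2 / lam l)"
      using lam by (intro sum_mono2) (force intro!: divide_nonneg_pos)+
    with R(1) show ?thesis by linarith
  qed
  have \<beta>: "0 \<le> \<beta>" "\<beta> \<le> 1"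
  proof -
    show "0 \<le> \<beta>" by (simp add: \<beta>_def sum_nonneg)
    have "\<beta> \<le> (\<Sum>l=1..n. (c l)\<^sup>2)" unfolding \<beta>_def by (intro sum_mono2) auto
    then show "\<beta> \<le> 1" using norm by simp
  qed
  \<comment> \<open>Subtracting \<open>\<kappa>\<close> times the normalization from the energy
    identity leaves nonpositive terms up to \<open>K\<close>.\<close>
  have tail: "\<theta> - \<kappa> \<le> (\<Sum>l\<in>{K<..n}. (c l)\<^sup>2 * (lam l - \<kappa>))"
  proof -
    have "\<theta> - \<kappa> = (\<Sum>l=1..n. lam l * (c l)\<^sup>2) - \<kappa> * (\<Sum>l=1..n. (c l)\<^sup>2)"
      using norm energy by simp
    also have "\<dots> = (\<Sum>l=1..n. (c l)\<^sup>2 * (lam l - \<kappa>))"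
      by (simp add: sum_distrib_left algebra_simps sum_subtractf)
    also have "\<dots> = (\<Sum>l=1..K. (c l)\<^sup>2 * (lam l - \<kappa>)) + (\<Sum>l\<in>{K<..n}. (c l)\<^sup>2 * (lam l - \<kappa>))"
      unfolding split(1) by (rule sum.union_disjoint) (use split in auto)
    also have "(\<Sum>l=1..K. (c l)\<^sup>2 * (lam l - \<kappa>)) \<le> 0"
      using low by (intro sum_nonpos mult_nonneg_nonpos) auto
    finally show ?thesis by simp
  qed
  have energy_tail: "(\<Sum>l\<in>{K<..n}. (c l)\<^sup>2 * lam l) \<le> R\<^sup>2 / d\<^sup>2"
  proof -
    have "(\<Sum>l\<in>{K<..n}. (c l)\<^sup>2 * lam l) \<le> (\<Sum>l\<in>{K<..n}. (c l)\<^sup>2 * (lam l - \<theta>)\<^sup>2 / lam l / d\<^sup>2)"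
    proof (rule sum_mono)
      fix l assume l: "l \<in> {K<..n}"
      have "(d * lam l)\<^sup>2 \<le> (lam l - \<theta>)\<^sup>2"
        using gap[OF l] pos[OF l] d(1) by (simp add: abs_le_square_iff[symmetric] abs_mult)
      then have "lam l \<le> (lam l - \<theta>)\<^sup>2 / lam l / d\<^sup>2"
        using pos[OF l] d(1) by (simp add: field_simps power2_eq_square)
      then have "(c l)\<^sup>2 * lam l \<le> (c l)\<^sup>2 * ((lam l - \<theta>)\<^sup>2 / lam l / d\<^sup>2)"
        by (intro mult_left_mono) auto
      then show "(c l)\<^sup>2 * lam l \<le> (c l)\<^sup>2 * (lam l - \<theta>)\<^sup>2 / lam l / d\<^sup>2" by simp
    qed
    also have "\<dots> \<le> R\<^sup>2 / d\<^sup>2"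
      unfolding sum_divide_distrib[symmetric] by (intro divide_right_mono R_tail) simp
    finally show ?thesis .
  qed
  have crude: "\<theta> - \<kappa> \<le> R\<^sup>2 / d\<^sup>2"
  proof -
    have "(\<Sum>l\<in>{K<..n}. (c l)\<^sup>2 * (lam l - \<kappa>)) \<le> (\<Sum>l\<in>{K<..n}. (c l)\<^sup>2 * lam l)"
      using \<kappa> by (intro sum_mono mult_left_mono) auto
    with tail energy_tail show ?thesis by linarith
  qed
  have \<beta>_bound: "\<beta> \<le> R / (d * sqrt \<kappa>)"
  proof -
    have "\<kappa> * \<beta> \<le> (\<Sum>l\<in>{K<..n}. (c l)\<^sup>2 * lam l)"
      unfolding \<beta>_def sum_distrib_left
      using high by (intro sum_mono) (simp add: mult.commute[of "(c _)\<^sup>2"] mult_right_mono)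
    with energy_tail have "\<kappa> * \<beta> \<le> R\<^sup>2 / d\<^sup>2" by linarith
    then have "\<beta> \<le> R\<^sup>2 / d\<^sup>2 / \<kappa>"
      using \<kappa>(1) by (subst pos_le_divide_eq) (simp_all add: mult.commute)
    also have "\<dots> = (R / (d * sqrt \<kappa>))\<^sup>2"
      using \<kappa>(1) by (simp add: power_divide power_mult_distrib)
    finally have "\<beta> \<le> (R / (d * sqrt \<kappa>))\<^sup>2" .
    \<comment> \<open>Weakening \<open>\<beta>\<close> to its square allows a square root to be
      taken, so that \<open>R\<close> enters to the first power.\<close>
    moreover have "\<beta>\<^sup>2 \<le> \<beta>"
      using \<beta> by (simp add: power2_eq_square mult_left_le)
    ultimately have "\<beta>\<^sup>2 \<le> (R / (d * sqrt \<kappa>))\<^sup>2" by linarith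
    then show ?thesis
      by (rule power2_le_imp_le) (use R(2) d(1) \<kappa>(1) in simp)
  qed
  have "(\<Sum>l\<in>{K<..n}. (c l)\<^sup>2 * (lam l - \<theta>)) \<le> (\<Sum>l\<in>{K<..n}. (c l)\<^sup>2 * (lam l - \<theta>)\<^sup>2 / lam l / d)"
  proof (rule sum_mono)
    fix l assume l: "l \<in> {K<..n}"
    have "lam l - \<theta> \<le> (lam l - \<theta>)\<^sup>2 / lam l / d"
    \<comment> \<open>The gap is an absolute value, so \<open>lam l\<close> may lie below
      \<open>\<theta>\<close>; then the left side is negative and the claim is immediate.\<close>
    proof (cases "\<theta> \<le> lam l")
      case True
      then have "(lam l - \<theta>) * (d * lam l) \<le> (lam l - \<theta>) * (lam l - \<theta>)"
        using gap[OF l] by (intro mult_left_mono) auto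
      then show ?thesis using pos[OF l] d(1) by (simp add: field_simps power2_eq_square)
    next
      case False
      then show ?thesis using pos[OF l] d(1)
        by (intro order_trans[OF _ divide_nonneg_pos[OF divide_nonneg_pos]]) auto
    qed
    then have "(c l)\<^sup>2 * (lam l - \<theta>) \<le> (c l)\<^sup>2 * ((lam l - \<theta>)\<^sup>2 / lam l / d)"
      by (intro mult_left_mono) auto
    then show "(c l)\<^sup>2 * (lam l - \<theta>) \<le> (c l)\<^sup>2 * (lam l - \<theta>)\<^sup>2 / lam l / d" by simp
  qed
  also have "\<dots> \<le> R\<^sup>2 / d"
    unfolding sum_divide_distrib[symmetric] using d(1) by (intro divide_right_mono R_tail) simp
  finally have first: "(\<Sum>l\<in>{K<..n}. (c l)\<^sup>2 * (lam l - \<theta>)) \<le> R\<^sup>2 / d" .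
  have "(\<Sum>l\<in>{K<..n}. (c l)\<^sup>2 * (lam l - \<kappa>)) =
      (\<Sum>l\<in>{K<..n}. (c l)\<^sup>2 * (lam l - \<theta>)) + (\<theta> - \<kappa>) * \<beta>"
    unfolding \<beta>_def sum_distrib_left by (simp add: sum.distrib[symmetric] algebra_simps)
  \<comment> \<open>Multiplying the two crude bounds produces the cubic correction term.\<close>
  moreover have "(\<theta> - \<kappa>) * \<beta> \<le> R\<^sup>2 / d\<^sup>2 * (R / (d * sqrt \<kappa>))"
    using crude \<beta>_bound \<beta>(1) by (intro mult_mono) auto
  ultimately have "\<theta> - \<kappa> \<le> R\<^sup>2 / d + R\<^sup>2 / d\<^sup>2 * (R / (d * sqrt \<kappa>))"
    using tail first by linarith
  also have "\<dots> = R\<^sup>2 / d * (1 + R / (d\<^sup>2 * sqrt \<kappa>))"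
    by (simp add: algebra_simps power2_eq_square)
  finally show ?thesis .
qed

text \<open>Monotonicity squeezes every index between two occurrences of a value, so the occurrences
  form an interval; counting them locates its end. \<open>1 \<le> q\<close> makes the set nonempty,
  so \<open>Min\<close> is meaningful.\<close>

lemma eigenvalue_cluster_indices:
  fixes lam :: "nat \<Rightarrow> real"
  assumes mono: "mono_on {1..n} lam"
    and k: "k = lowest_index lam n i" and q: "q = eigen_multiplicity lam n i" "1 \<le> q"
  shows "1 \<le> k" "k + q - 1 \<le> n" "\<And>l. l \<in> {k..k + q - 1} \<Longrightarrow> lam l = lam k"
proof -
  define T where "T = {l \<in> {1..n}. lam l = distinct_value lam n i}"
  have fin: "finite T" by (simp add: T_def)
  have card: "card T = q" using q by (simp add: T_def eigen_multiplicity_def)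
  then have ne: "T \<noteq> {}" using q(2) by auto
  have k': "k = Min T" by (simp add: k lowest_index_def T_def)
  then have kT: "k \<in> T" using Min_in fin ne by simp
  have MT: "Max T \<in> T" using Max_in fin ne by simp
  have "T = {k..Max T}"
  proof
    show "T \<subseteq> {k..Max T}" using fin k' by auto
    show "{k..Max T} \<subseteq> T"
    proof
      fix l assume l: "l \<in> {k..Max T}"
      then have "l \<in> {1..n}" using kT MT by (auto simp: T_def)
      moreover have "k \<in> {1..n}" "Max T \<in> {1..n}" using kT MT by (simp_all add: T_def)
      ultimately have "lam k \<le> lam l" "lam l \<le> lam (Max T)"
        using l by (auto intro: mono_onD[OF mono])
      then show "l \<in> T" using kT MT \<open>l \<in> {1..n}\<close> by (simp add: T_def)
    qed
  qed
  moreover have "k \<le> Max T" using fin kT by simp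
  ultimately have "Max T = k + q - 1" using card by (metis Suc_diff_le card_atLeastAtMost diff_Suc_1 le_add_diff_inverse add_Suc_right)
  with \<open>T = {k..Max T}\<close> have T: "T = {k..k + q - 1}" by simp
  show "1 \<le> k" using kT by (simp add: T_def)
  show "k + q - 1 \<le> n" using MT \<open>Max T = k + q - 1\<close> by (simp add: T_def)
  show "lam l = lam k" if "l \<in> {k..k + q - 1}" for l
    using that kT unfolding T[symmetric] by (simp add: T_def)
qed

section \<open>Expansion in eigenfunctions\<close>

lemma function_subspace_sum:
  assumes V: "function_subspace V" and f: "\<And>i. i \<in> I \<Longrightarrow> f i \<in> V"
  shows "(\<lambda>x. \<Sum>i\<in>I. c i *\<^sub>R f i x) \<in> V"
  using f V by (induction I rule: infinite_finite_induct) (auto simp: function_subspace_def)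

lemma ae_zero_sum:
  assumes "\<And>i. i \<in> I \<Longrightarrow> ae_zero \<Omega> (f i)"
  shows "ae_zero \<Omega> (\<lambda>x. \<Sum>i\<in>I. c i *\<^sub>R f i x)"
proof (cases "finite I")
  case True
  have "AE x in lebesgue_on \<Omega>. \<forall>i\<in>I. f i x = 0"
    using assms True by (intro AE_finite_allI) (auto simp: ae_zero_def)
  then show ?thesis unfolding ae_zero_def by eventually_elim simp
qed (simp add: ae_zero_def)

text \<open>The remainder of the projection is orthogonal to all \<open>u l\<close>. Were it not
  null, it would give \<open>n + 1\<close> mutually orthogonal non-null elements in dimension
  \<open>n\<close>.\<close>

lemma AE_orthonormal_expansion:
  assumes V: "function_subspace V" "V \<subseteq> L2 \<Omega>" "has_dimension \<Omega> V n"
    and u: "\<And>l. l \<in> {1..n} \<Longrightarrow> u l \<in> V"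
    and orth: "\<And>l l'. l \<in> {1..n} \<Longrightarrow> l' \<in> {1..n} \<Longrightarrow> m_form \<Omega> (u l) (u l') = (if l = l' then 1 else 0)"
    and v: "v \<in> V"
  shows "AE x in lebesgue_on \<Omega>. v x = (\<Sum>l=1..n. m_form \<Omega> (u l) v *\<^sub>R u l x)"
proof -
  let ?p = "\<lambda>x. \<Sum>l=1..n. m_form \<Omega> (u l) v *\<^sub>R u l x"
  define z where "z x = v x + (- 1) *\<^sub>R ?p x" for x
  have p: "?p \<in> V" using V(1) u by (rule function_subspace_sum)
  have add: "(\<lambda>x. f x + g x) \<in> V" if "f \<in> V" "g \<in> V" for f g
    using V(1) that by (simp add: function_subspace_def)
  have scale: "(\<lambda>x. a *\<^sub>R f x) \<in> V" if "f \<in> V" for a f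
    using V(1) that by (simp add: function_subspace_def)
  have z: "z \<in> V"
    unfolding z_def[abs_def] by (intro add scale v p)
  have L2: "w \<in> L2 \<Omega>" if "w \<in> V" for w using V(2) that by blast
  have m_z: "m_form \<Omega> z w = m_form \<Omega> v w - m_form \<Omega> ?p w" if "w \<in> V" for w
    using L2_inner_integrable[OF L2[OF v] L2[OF that]] L2_inner_integrable[OF L2[OF p] L2[OF that]]
    by (simp add: m_form_def z_def inner_diff_left)
  have z_orth: "m_form \<Omega> z (u l) = 0" if l: "l \<in> {1..n}" for l
  proof -
    have "m_form \<Omega> ?p (u l) = (\<Sum>l'=1..n. m_form \<Omega> (u l') v * m_form \<Omega> (u l') (u l))"
      by (rule m_form_sum_left) (use l u L2 in auto)
    also have "\<dots> = (\<Sum>l'=1..n. if l' = l then m_form \<Omega> (u l) v else 0)"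
      by (rule sum.cong) (use l orth in auto)
    also have "\<dots> = m_form \<Omega> (u l) v" using l by simp
    finally show ?thesis using m_z[OF u[OF l]] by (simp add: m_form_commute)
  qed
  have "ae_zero \<Omega> z"
  proof (rule ccontr)
    assume nz: "\<not> ae_zero \<Omega> z"
    then have mz: "m_form \<Omega> z z \<noteq> 0" using m_form_self_eq_0_iff[OF L2[OF z]] by simp
    \<comment> \<open>The eigenfunctions occupy indices from 1, so slot 0 is free for the remainder
      and \<open>{0..n}\<close> has \<open>n + 1\<close> elements.\<close>
    define f where "f = u(0 := z)"
    have fV: "f i \<in> V" if "i \<in> {0..n}" for i using that u z by (auto simp: f_def)
    have f_orth: "m_form \<Omega> (f i) (f i') = 0" if "i \<in> {0..n}" "i' \<in> {0..n}" "i \<noteq> i'" for i i'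
      using that orth z_orth m_form_commute[of \<Omega> z] by (auto simp: f_def)
    have f_self: "m_form \<Omega> (f i) (f i) \<noteq> 0" if "i \<in> {0..n}" for i
      using that orth mz by (auto simp: f_def)
    obtain b where b: "\<And>v. v \<in> V \<Longrightarrow> \<exists>c. ae_zero \<Omega> (\<lambda>x. v x - (\<Sum>j<n. c j *\<^sub>R b j x))"
      using V(3) by (auto simp: has_dimension_def)
    then have "\<forall>i\<in>{0..n}. \<exists>c. ae_zero \<Omega> (\<lambda>x. f i x - (\<Sum>j<n. c j *\<^sub>R b j x))"
      using fV by blast
    from bchoice[OF this] obtain A
      where A: "\<forall>i\<in>{0..n}. ae_zero \<Omega> (\<lambda>x. f i x - (\<Sum>j<n. A i j *\<^sub>R b j x))" ..
    obtain \<beta> where \<beta>: "\<exists>i\<in>{0..n}. \<beta> i \<noteq> 0" "\<forall>j<n. (\<Sum>i\<in>{0..n}. \<beta> i * A i j) = 0"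
      using homogeneous_system_nontrivial_solution[of "{0..n}" n A] by auto
    let ?y = "\<lambda>x. \<Sum>i\<in>{0..n}. \<beta> i *\<^sub>R f i x"
    have "ae_zero \<Omega> (\<lambda>x. \<Sum>i\<in>{0..n}. \<beta> i *\<^sub>R (f i x - (\<Sum>j<n. A i j *\<^sub>R b j x)))"
      by (rule ae_zero_sum) (use A in blast)
    moreover have "(\<Sum>i\<in>{0..n}. \<beta> i *\<^sub>R (f i x - (\<Sum>j<n. A i j *\<^sub>R b j x))) = ?y x" for x
    proof -
      have "(\<Sum>i\<in>{0..n}. \<beta> i *\<^sub>R (\<Sum>j<n. A i j *\<^sub>R b j x)) =
          (\<Sum>i\<in>{0..n}. \<Sum>j<n. (\<beta> i * A i j) *\<^sub>R b j x)"
        by (simp add: scaleR_sum_right)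
      also have "\<dots> = (\<Sum>j<n. \<Sum>i\<in>{0..n}. (\<beta> i * A i j) *\<^sub>R b j x)"
        by (rule sum.swap)
      also have "\<dots> = (\<Sum>j<n. (\<Sum>i\<in>{0..n}. \<beta> i * A i j) *\<^sub>R b j x)"
        by (simp add: scaleR_sum_left)
      also have "\<dots> = 0" using \<beta>(2) by simp
      finally show ?thesis by (simp add: scaleR_diff_right sum_subtractf)
    qed
    ultimately have y0: "AE x in lebesgue_on \<Omega>. ?y x = 0" by (simp add: ae_zero_def)
    obtain i where i: "i \<in> {0..n}" "\<beta> i \<noteq> 0" using \<beta>(1) by blast
    \<comment> \<open>Pairing the vanishing combination with \<open>f i\<close> isolates the nonzero
      coefficient \<open>\<beta> i\<close>, a contradiction.\<close>
    have "m_form \<Omega> ?y (f i) = m_form \<Omega> (\<lambda>_. 0) (f i)"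
      using y0 i fV by (intro m_form_cong_left L2 L2_zero function_subspace_sum[OF V(1)]) auto
    moreover have "m_form \<Omega> ?y (f i) = (\<Sum>i'\<in>{0..n}. \<beta> i' * m_form \<Omega> (f i') (f i))"
      using fV i(1) by (intro m_form_sum_left L2) auto
    moreover have "\<dots> = (\<Sum>i'\<in>{0..n}. if i' = i then \<beta> i * m_form \<Omega> (f i) (f i) else 0)"
      by (intro sum.cong) (use i(1) f_orth in auto)
    ultimately show False using i f_self[OF i(1)] by (simp add: m_form_def)
  qed
  then show ?thesis unfolding ae_zero_def by eventually_elim (simp add: z_def)
qed

section \<open>Spectral representation of the forms and of the dual norm\<close>

context
  fixes \<Omega> :: "(real^'d) set" and C :: "real^'d \<Rightarrow> real^'d^'d^'d^'d" and D V n lam u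
  assumes \<Omega>: "open \<Omega>" "bounded \<Omega>"
    and D: "nonoverlapping_decomposition \<Omega> D" and C: "hooke_tensor_field D C"
    and V: "function_subspace V" "V \<subseteq> H1 \<Omega>" "has_dimension \<Omega> V n"
    and pos: "\<And>v. v \<in> V \<Longrightarrow> \<not> ae_zero \<Omega> v \<Longrightarrow> 0 < a_form \<Omega> C v v"
    and eig: "eigen_system \<Omega> C V n lam u"
begin

lemma V_L2: "V \<subseteq> L2 \<Omega>"
  using V(2) H1_imp_L2 by blast

lemma eigenfunction_in_V: "l \<in> {1..n} \<Longrightarrow> u l \<in> V"
  using eig by (simp add: eigen_system_def)

lemma eigenfunctions_orthonormal:
  "l \<in> {1..n} \<Longrightarrow> l' \<in> {1..n} \<Longrightarrow> m_form \<Omega> (u l) (u l') = (if l = l' then 1 else 0)"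
  using eig by (simp add: eigen_system_def)

lemma eigenfunction_eq:
  "l \<in> {1..n} \<Longrightarrow> v \<in> V \<Longrightarrow> a_form \<Omega> C (u l) v = lam l * m_form \<Omega> (u l) v"
  using eig by (simp add: eigen_system_def)

text \<open>Testing the eigenvalue equation with the normalized eigenfunction itself gives the
  eigenvalue as an energy.\<close>

lemma eigenvalue_pos:
  assumes l: "l \<in> {1..n}"
  shows "0 < lam l"
proof -
  have "m_form \<Omega> (u l) (u l) = 1" using eigenfunctions_orthonormal l by simp
  moreover from this have "\<not> ae_zero \<Omega> (u l)"
    using m_form_self_eq_0_iff[of "u l" \<Omega>] V_L2 eigenfunction_in_V[OF l] by auto
  ultimately show ?thesis
    using pos[OF eigenfunction_in_V[OF l]] eigenfunction_eq[OF l eigenfunction_in_V[OF l]] by simp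
qed

lemma m_form_expansion:
  assumes v: "v \<in> V" and w: "w \<in> V"
  shows "m_form \<Omega> v w = (\<Sum>l=1..n. m_form \<Omega> (u l) v * m_form \<Omega> (u l) w)"
proof -
  let ?p = "\<lambda>x. \<Sum>l=1..n. m_form \<Omega> (u l) v *\<^sub>R u l x"
  have p: "?p \<in> V" using V(1) eigenfunction_in_V by (rule function_subspace_sum)
  have "m_form \<Omega> v w = m_form \<Omega> ?p w"
    using V_L2 v w p
      AE_orthonormal_expansion[OF V(1) V_L2 V(3) eigenfunction_in_V eigenfunctions_orthonormal v]
    by (intro m_form_cong_left) auto
  also have "\<dots> = (\<Sum>l=1..n. m_form \<Omega> (u l) v * m_form \<Omega> (u l) w)"
    using V_L2 w eigenfunction_in_V by (intro m_form_sum_left) auto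
  finally show ?thesis .
qed

text \<open>The first argument may be replaced by its expansion because the form respects
  almost-everywhere equality; the eigenvalue equation then diagonalizes it.\<close>

lemma a_form_expansion:
  assumes v: "v \<in> V" and w: "w \<in> V"
  shows "a_form \<Omega> C v w = (\<Sum>l=1..n. lam l * m_form \<Omega> (u l) v * m_form \<Omega> (u l) w)"
proof -
  let ?p = "\<lambda>x. \<Sum>l=1..n. m_form \<Omega> (u l) v *\<^sub>R u l x"
  have p: "?p \<in> V" using V(1) eigenfunction_in_V by (rule function_subspace_sum)
  have "a_form \<Omega> C v w = a_form \<Omega> C ?p w"
    using V(2) v w p
      AE_orthonormal_expansion[OF V(1) V_L2 V(3) eigenfunction_in_V eigenfunctions_orthonormal v]
    by (intro a_form_cong_left[OF \<Omega> D C]) auto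
  also have "\<dots> = (\<Sum>l=1..n. m_form \<Omega> (u l) v * a_form \<Omega> C (u l) w)"
    using V(2) w eigenfunction_in_V by (intro a_form_sum_left[OF \<Omega> D C]) auto
  also have "\<dots> = (\<Sum>l=1..n. lam l * m_form \<Omega> (u l) v * m_form \<Omega> (u l) w)"
    using w by (intro sum.cong) (simp_all add: eigenfunction_eq)
  finally show ?thesis .
qed

lemma m_form_eigenfunction_combination:
  assumes "l \<in> {1..n}"
  shows "m_form \<Omega> (u l) (\<lambda>x. \<Sum>l=1..n. y l *\<^sub>R u l x) = y l"
proof -
  have "m_form \<Omega> (\<lambda>x. \<Sum>l=1..n. y l *\<^sub>R u l x) (u l) = (\<Sum>l'=1..n. y l' * m_form \<Omega> (u l') (u l))"
    using assms V_L2 eigenfunction_in_V by (intro m_form_sum_left) auto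
  also have "\<dots> = (\<Sum>l'=1..n. if l' = l then y l else 0)"
    by (rule sum.cong) (use assms eigenfunctions_orthonormal in auto)
  finally show ?thesis using assms by (simp add: m_form_commute)
qed

text \<open>
  The supremum is attained at the Riesz representative of the residual, whose coordinates are
  \<open>c l * (lam l - \<theta>) / lam l\<close>. If it vanishes, any eigenfunction shows that the supremum is nonnegative.
\<close>

lemma residual_dual_norm_bound:
  assumes w: "w \<in> V" and n: "1 \<le> n"
  defines "c \<equiv> \<lambda>l. m_form \<Omega> (u l) w"
  shows "0 \<le> dual_norm \<Omega> C V (residual \<Omega> C w \<theta>)" (is "0 \<le> ?R")
    and "(\<Sum>l=1..n. (c l)\<^sup>2 * (lam l - \<theta>)\<^sup>2 / lam l) \<le> (dual_norm \<Omega> C V (residual \<Omega> C w \<theta>))\<^sup>2"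
      (is "?S \<le> _")
proof -
  let ?r = "residual \<Omega> C w \<theta>"
  have r: "?r v = (\<Sum>l=1..n. c l * (lam l - \<theta>) * m_form \<Omega> (u l) v)" if "v \<in> V" for v
    unfolding residual_def a_form_expansion[OF w that] m_form_expansion[OF w that] c_def
    by (simp add: sum_distrib_left sum_subtractf[symmetric] algebra_simps)
  have S_nonneg: "0 \<le> ?S"
    using eigenvalue_pos by (intro sum_nonneg divide_nonneg_pos) auto
  have r_le: "?r v / energy_norm \<Omega> C v \<le> sqrt ?S" if v: "v \<in> V" "\<not> ae_zero \<Omega> v" for v
  proof -
    have a: "0 < a_form \<Omega> C v v" using pos v by blast
    \<comment> \<open>The factors \<open>sqrt (lam l)\<close> are inserted so that Cauchy-Schwarz
      yields the energy of \<open>v\<close> in the second sum.\<close>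
    have "(?r v)\<^sup>2 = (\<Sum>l=1..n. (c l * (lam l - \<theta>) / sqrt (lam l)) * (sqrt (lam l) * m_form \<Omega> (u l) v))\<^sup>2"
      unfolding r[OF v(1)] using eigenvalue_pos by (intro arg_cong[where f="\<lambda>x. x\<^sup>2"] sum.cong) force+
    also have "\<dots> \<le> (\<Sum>l=1..n. (c l * (lam l - \<theta>) / sqrt (lam l))\<^sup>2) *
        (\<Sum>l=1..n. (sqrt (lam l) * m_form \<Omega> (u l) v)\<^sup>2)"
      by (rule Cauchy_Schwarz_ineq_sum)
    also have "(\<Sum>l=1..n. (c l * (lam l - \<theta>) / sqrt (lam l))\<^sup>2) = ?S"
      using eigenvalue_pos by (intro sum.cong) (force simp: power_divide power_mult_distrib)+
    also have "(\<Sum>l=1..n. (sqrt (lam l) * m_form \<Omega> (u l) v)\<^sup>2) = a_form \<Omega> C v v"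
      unfolding a_form_expansion[OF v(1) v(1)] using eigenvalue_pos
      by (intro sum.cong) (force simp: power2_eq_square power_mult_distrib mult_ac)+
    finally have "(?r v)\<^sup>2 \<le> ?S * a_form \<Omega> C v v" .
    then have "?r v \<le> sqrt (?S * a_form \<Omega> C v v)" by (rule real_le_rsqrt)
    then show ?thesis
      using a by (simp add: energy_norm_def real_sqrt_mult pos_divide_le_eq)
  qed
  \<comment> \<open>A real supremum dominates its members only if the set is bounded above.\<close>
  have bdd: "bdd_above ((\<lambda>v. ?r v / energy_norm \<Omega> C v) ` {v \<in> V. \<not> ae_zero \<Omega> v})"
    using r_le by (intro bdd_aboveI2[where M="sqrt ?S"]) auto
  have R_ge: "?r v / energy_norm \<Omega> C v \<le> ?R" if "v \<in> V" "\<not> ae_zero \<Omega> v" for v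
    unfolding dual_norm_def using that by (intro cSUP_upper bdd) auto
  have "sqrt ?S \<le> ?R"
  proof (cases "?S = 0")
    case True
    then have "(c 1)\<^sup>2 * (lam 1 - \<theta>)\<^sup>2 / lam 1 = 0"
      using eigenvalue_pos n
      by (subst (asm) sum_nonneg_eq_0_iff) (auto intro!: divide_nonneg_pos)
    then have c1: "c 1 * (lam 1 - \<theta>) = 0" using eigenvalue_pos[of 1] n by auto
    have u1: "u 1 \<in> V" "m_form \<Omega> (u 1) (u 1) = 1"
      using eigenfunction_in_V eigenfunctions_orthonormal n by auto
    then have "\<not> ae_zero \<Omega> (u 1)" using m_form_self_eq_0_iff[of "u 1" \<Omega>] V_L2 by auto
    moreover have "?r (u 1) = 0"
    proof -
      have "?r (u 1) = (\<Sum>l=1..n. if l = 1 then c 1 * (lam 1 - \<theta>) else 0)"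
        unfolding r[OF u1(1)] using n by (intro sum.cong) (auto simp: eigenfunctions_orthonormal)
      then show ?thesis using c1 n by simp
    qed
    ultimately show ?thesis using R_ge[OF u1(1)] True by simp
  next
    case False
    with S_nonneg have S: "0 < ?S" by simp
    define y where "y l = c l * (lam l - \<theta>) / lam l" for l
    define v where "v = (\<lambda>x. \<Sum>l=1..n. y l *\<^sub>R u l x)"
    have v: "v \<in> V" unfolding v_def using V(1) eigenfunction_in_V by (rule function_subspace_sum)
    have y: "m_form \<Omega> (u l) v = y l" if "l \<in> {1..n}" for l
      unfolding v_def using that by (rule m_form_eigenfunction_combination)
    \<comment> \<open>Residual and energy of the representative are both \<open>?S\<close>, so its
      quotient is \<open>sqrt ?S\<close>.\<close>
    have rv: "?r v = ?S"
      unfolding r[OF v] by (intro sum.cong) (simp_all add: y y_def power2_eq_square)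
    have av: "a_form \<Omega> C v v = ?S"
      unfolding a_form_expansion[OF v v] using eigenvalue_pos
      by (intro sum.cong) (force simp: y y_def power2_eq_square)+
    have "\<not> ae_zero \<Omega> v"
    proof
      assume "ae_zero \<Omega> v"
      then have "m_form \<Omega> v (u l) = 0" if "l \<in> {1..n}" for l
        using m_form_cong_left[of v \<Omega> "\<lambda>_. 0" "u l"] V_L2 v eigenfunction_in_V[OF that]
        by (auto simp: ae_zero_def L2_zero m_form_def)
      then have "?r v = 0" unfolding r[OF v] by (simp add: m_form_commute)
      then show False using rv S by simp
    qed
    from R_ge[OF v this] show ?thesis
      using S by (simp add: rv av energy_norm_def real_div_sqrt)
  qed
  then show "0 \<le> ?R" using S_nonneg by (meson order_trans real_sqrt_ge_zero)
  show "?S \<le> ?R\<^sup>2"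
    using \<open>sqrt ?S \<le> ?R\<close> by (rule sqrt_le_D)
qed

end

section \<open>The error bound for reduced eigenvalues\<close>

theorem theorem3p1:
  fixes \<Omega> \<Gamma>\<^sub>D :: "(real^'d) set"
    and D :: "(real^'d) set set"
    and P :: "(real^'p) set"
    and C :: "real^'p \<Rightarrow> real^'d \<Rightarrow> real^'d^'d^'d^'d"
    and V V\<^sub>N :: "(real^'d \<Rightarrow> real^'d) set"
    and \<mu> :: "real^'p"
    and dimV N i j k q :: nat
    and lam lam_red :: "nat \<Rightarrow> real"
    and u u_red :: "nat \<Rightarrow> real^'d \<Rightarrow> real^'d"
    and d R :: real
  assumes "CARD('d) = 2 \<or> CARD('d) = 3"
    and "polyhedral_domain \<Omega>"
    and "closed \<Gamma>\<^sub>D" and "\<Gamma>\<^sub>D \<noteq> {}" and "\<Gamma>\<^sub>D \<subseteq> frontier \<Omega>"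
    and "nonoverlapping_decomposition \<Omega> D"
    and "\<And>\<nu>. \<nu> \<in> P \<Longrightarrow> hooke_tensor_field D (C \<nu>)"
    and "function_subspace V" and "V \<subseteq> H1_Dirichlet \<Omega> \<Gamma>\<^sub>D" and "has_dimension \<Omega> V dimV"
    and "\<And>\<nu> v. \<nu> \<in> P \<Longrightarrow> v \<in> V \<Longrightarrow> \<not> ae_zero \<Omega> v \<Longrightarrow> a_form \<Omega> (C \<nu>) v v > 0"
    and "function_subspace V\<^sub>N" and "V\<^sub>N \<subseteq> V" and "has_dimension \<Omega> V\<^sub>N N" and "N < dimV"
    and "\<mu> \<in> P"
    and "eigen_system \<Omega> (C \<mu>) V dimV lam u"
    and "eigen_system \<Omega> (C \<mu>) V\<^sub>N N lam_red u_red"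
    and "1 \<le> i" and "i \<le> num_distinct lam dimV"
    and "k = lowest_index lam dimV i" and "q = eigen_multiplicity lam dimV i"
    and "k + q - 1 \<le> N"
    and "j \<in> {1..q}"
    and "d = (MIN l\<in>{k + q - 1<..dimV}. \<bar>(lam l - lam_red (k + j - 1)) / lam l\<bar>)"
    and "d \<noteq> 0"
    and "R = dual_norm \<Omega> (C \<mu>) V (residual \<Omega> (C \<mu>) (u_red (k + j - 1)) (lam_red (k + j - 1)))"
  shows "0 \<le> lam_red (k + j - 1) - lam k \<and>
         lam_red (k + j - 1) - lam k \<le> R\<^sup>2 / d * (1 + R / (d\<^sup>2 * sqrt (lam k)))"
proof -
  define s where "s = k + j - 1"
  define w where "w = u_red s"
  have \<Omega>: "open \<Omega>" "bounded \<Omega>" using assms(2) by (auto simp: polyhedral_domain_def)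
  have V: "V \<subseteq> H1 \<Omega>" using assms(9) by (auto simp: H1_Dirichlet_def)
  note spectral = \<Omega> assms(6) assms(7)[OF assms(16)] assms(8) V assms(10) assms(11)[OF assms(16)] assms(17)
  have lam_mono: "mono_on {1..dimV} lam" using assms(17) by (simp add: eigen_system_def)
  have "1 \<le> q" using assms(24) by auto
  note cluster = eigenvalue_cluster_indices[OF lam_mono assms(21) assms(22) this]
  have k: "k \<in> {1..dimV}" using cluster \<open>1 \<le> q\<close> by auto
  have s: "s \<in> {k..k + q - 1}" using assms(24) by (auto simp: s_def)
  \<comment> \<open>The chain \<open>s \<le> k + q - 1 \<le> N < dimV\<close> lets \<open>s\<close>
    index both the reduced and the detailed system.\<close>
  then have sN: "s \<in> {1..N}" and s_dim: "s \<in> {1..dimV}" using cluster(1) assms(15,23) by auto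
  have red: "u_red t \<in> V\<^sub>N" "u_red t \<in> V" if "t \<in> {1..N}" for t
    using assms(13,18) that by (auto simp: eigen_system_def)
  have red_m: "m_form \<Omega> (u_red t) (u_red t') = (if t = t' then 1 else 0)"
    and red_a: "a_form \<Omega> (C \<mu>) (u_red t) (u_red t') = (if t = t' then lam_red t else 0)"
    if "t \<in> {1..N}" "t' \<in> {1..N}" for t t'
    using assms(18) that by (auto simp: eigen_system_def)
  have "lam s \<le> lam_red s"
  proof (rule ritz_value_ge_eigenvalue[OF lam_mono _ s_dim])
    have "mono_on {1..N} lam_red" using assms(18) by (simp add: eigen_system_def)
    then show "mono_on {1..s} lam_red" by (rule mono_on_subset) (use sN in auto)
    fix t t' assume t: "t \<in> {1..s}" "t' \<in> {1..s}"
    then have tN: "t \<in> {1..N}" "t' \<in> {1..N}" using sN by auto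
    show "(\<Sum>l=1..dimV. m_form \<Omega> (u l) (u_red t) * m_form \<Omega> (u l) (u_red t')) = (if t = t' then 1 else 0)"
      using m_form_expansion[OF spectral red(2)[OF tN(1)] red(2)[OF tN(2)]] red_m[OF tN] by simp
    show "(\<Sum>l=1..dimV. lam l * m_form \<Omega> (u l) (u_red t) * m_form \<Omega> (u l) (u_red t')) =
        (if t = t' then lam_red t else 0)"
      using a_form_expansion[OF spectral red(2)[OF tN(1)] red(2)[OF tN(2)]] red_a[OF tN] by simp
  qed
  \<comment> \<open>Min-max compares equal indices; \<open>s\<close> lies in the cluster, so
    \<open>lam s\<close> is \<open>lam k\<close>.\<close>
  then have lower: "lam k \<le> lam_red s" using cluster(3)[OF s] by simp
  have w: "w \<in> V" using red(2)[OF sN] by (simp add: w_def)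
  let ?c = "\<lambda>l. m_form \<Omega> (u l) w"
  \<comment> \<open>The range of the minimum is nonempty because
    \<open>k + q - 1 \<le> N < dimV\<close>.\<close>
  have fin: "finite {k + q - 1<..dimV}" "{k + q - 1<..dimV} \<noteq> {}" using assms(15,23) by auto
  have d_le: "d \<le> \<bar>(lam l - lam_red s) / lam l\<bar>" if "l \<in> {k + q - 1<..dimV}" for l
    unfolding assms(25) s_def[symmetric] using fin that by (intro Min_le) auto
  \<comment> \<open>The minimum is attained, so \<open>d\<close> is an absolute value and being
    nonzero makes it positive.\<close>
  have "d \<in> (\<lambda>l. \<bar>(lam l - lam_red s) / lam l\<bar>) ` {k + q - 1<..dimV}"
    unfolding assms(25) s_def[symmetric] using fin by (intro Min_in) auto
  then have d: "0 < d" using assms(26) by auto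
  have R: "R = dual_norm \<Omega> (C \<mu>) V (residual \<Omega> (C \<mu>) w (lam_red s))"
    using assms(27) by (simp add: s_def w_def)
  have "lam_red s - lam k \<le> R\<^sup>2 / d * (1 + R / (d\<^sup>2 * sqrt (lam k)))"
  proof (rule spectral_gap_bound[where c = ?c and lam = lam and K = "k + q - 1" and n = dimV])
    show "0 < lam l" if "l \<in> {1..dimV}" for l by (rule eigenvalue_pos[OF spectral that])
    show "0 < lam k" by (rule eigenvalue_pos[OF spectral k])
    show "lam l \<le> lam k" if l: "l \<in> {1..k + q - 1}" for l
    proof (cases "k \<le> l")
      case True
      then show ?thesis using cluster(3)[of l] l by simp
    next
      case False
      then show ?thesis using l k by (intro mono_onD[OF lam_mono]) auto
    qed
    show "lam k \<le> lam l" if "l \<in> {k + q - 1<..dimV}" for l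
      using that k \<open>1 \<le> q\<close> by (intro mono_onD[OF lam_mono]) auto
    show "k + q - 1 < dimV" using assms(15,23) by simp
    show "lam k \<le> lam_red s" by (rule lower)
    show "(\<Sum>l=1..dimV. (?c l)\<^sup>2) = 1"
      using m_form_expansion[OF spectral w w] red_m[OF sN sN] by (simp add: w_def power2_eq_square)
    show "(\<Sum>l=1..dimV. lam l * (?c l)\<^sup>2) = lam_red s"
      using a_form_expansion[OF spectral w w] red_a[OF sN sN]
      by (simp add: w_def power2_eq_square mult.assoc)
    have "1 \<le> dimV" using assms(15) by simp
    note bound = residual_dual_norm_bound[OF spectral w this, of "lam_red s"]
    show "0 \<le> R" unfolding R by (rule bound(1))
    show "(\<Sum>l=1..dimV. (?c l)\<^sup>2 * (lam l - lam_red s)\<^sup>2 / lam l) \<le> R\<^sup>2"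
      unfolding R by (rule bound(2))
    show "0 < d" by (rule d)
    show "d \<le> \<bar>(lam l - lam_red s) / lam l\<bar>" if "l \<in> {k + q - 1<..dimV}" for l
      using that by (rule d_le)
  qed
  with lower show ?thesis by (simp add: s_def)
qed

end
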